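(* Let $G$ be a finite simple graph. As a graded vector space, the cohomology $H^\bullet(\mathcal L(G))$ of $\mathcal L(G)$ is canonically isomorphic to the direct sum of the essential cohomologies of the induced subgraphs of $G$, i.e. canonically $$H^\bullet(\mathcal L(G))\cong\bigoplus_{S\subseteq V(G)}\mathcal H^\bullet(G[S]).$$ In particular, $$b_i(G)=\sum_{S\subseteq V(G)}\beta_i(G[S]).$$
   Context: For a finite simple graph $G$ with vertex set $V(G)=\{1,\dots,n\}$ (or any finite totally ordered set) and edge set $E(G)$, the Dani-Mainkar Lie algebra $\mathcal L(G)$ is the real 2-step nilpotent Lie algebra with basis $x_i$ ($i\in V(G)$) and $x_{i,j}$ ($\{i,j\}\in E(G)$, $i<j$), with $[x_i,x_j]=x_{i,j}=-[x_j,x_i]$ if $\{i,j\}\in E(G)$ and $i<j$, all other brackets of basis elements being zero. $\mathcal C^\bullet(G)$ is the Cartan-Chevalley-Eilenberg complex of $\mathcal L(G)$: the full exterior algebra of the dual of $\mathcal L(G)$, i.e. the space of skew-commuting real polynomials in the variables $x_i^*$ ($i\in V(G)$) and $x_{i,j}^*$ ($\{i,j\}\in E(G)$, $i<j$), all in degree 1, with differential the odd derivation $Q$ such that $Q(x_i^* )=0$ and $Q(x_{i,j}^* )=x_i^*x_j^*$ for $i<j$. Its cohomology is $H^\bullet(\mathcal L(G))$, and $b_i(G)=\dim H^i(\mathcal L(G))$. For $S\subseteq V(G)$, $G[S]$ is the induced subgraph on $S$, and $\mathcal C^\bullet(G,S)\subseteq\mathcal C^\bullet(G)$ is the subcomplex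 spanned by all monomials $x_{i_1}^*\cdots x_{i_p}^*x_{r_1,s_1}^*\cdots x_{r_q,s_q}^*$ with $i_a\in V(G)$, $\{r_b,s_b\}\in E(G)$ and $\{i_1,\dots,i_p,r_1,s_1,\dots,r_q,s_q\}=S$ as sets (repetitions of vertices allowed). By convention, $\mathcal C^\bullet(G,\emptyset)$ is the trivial complex whose graded components are all zero-dimensional. The essential cohomology of a finite simple graph $H$ is $\mathcal H^\bullet(H)$, the cohomology of $\mathcal C^\bullet(H,V(H))$, and $\beta_i(H)=\dim\mathcal H^i(H)$. "Canonically" means: the isomorphism is the one induced by the chain maps $\mathcal C^\bullet(G[S],S)\to\mathcal C^\bullet(G)$ sending each monomial to itself.
   Formalization: With the convention that C(G,∅) is zero the claim fails in degree 0 (b_0(G)=1, but all β_0 vanish); it is proved for degrees i≥1 under that convention, and for all degrees i when C(∅,∅) is instead taken to be spanned by the monomial 1. *)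

theory Defs
  imports "HOL-Analysis.Analysis" "HOL-Analysis.Finite_Function_Topology"
begin

section \<open>Finite simple graphs\<close>

record 'a graph =
  vertices :: "'a set"
  edges :: "'a set set"

definition simple_graph :: "'a graph \<Rightarrow> bool" where
  "simple_graph G \<longleftrightarrow>
     finite (vertices G) \<and> (\<forall>e\<in>edges G. e \<subseteq> vertices G \<and> card e = 2)"

definition induced :: "'a graph \<Rightarrow> 'a set \<Rightarrow> 'a graph" where
  "induced G S = \<lparr>vertices = S, edges = {e \<in> edges G. e \<subseteq> S}\<rparr>"


section \<open>Generators\<close>

text \<open>\<open>Vtx i\<close> stands for the basis vector $x_i$ of the Lie algebra (and for the dual variable
  $x_i^*$), \<open>Edg i j\<close> with \<open>i < j\<close> for $x_{i,j}$ (and $x_{i,j}^*$). The linear order on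
  generators only fixes which ordering of a product of distinct variables is the
  distinguished one.\<close>

datatype 'a gen = Vtx 'a | Edg 'a 'a

instantiation gen :: (linorder) linorder
begin

fun less_eq_gen :: "'a gen \<Rightarrow> 'a gen \<Rightarrow> bool" where
  "less_eq_gen (Vtx i) (Vtx j) \<longleftrightarrow> i \<le> j"
| "less_eq_gen (Vtx i) (Edg k l) \<longleftrightarrow> True"
| "less_eq_gen (Edg i j) (Vtx k) \<longleftrightarrow> False"
| "less_eq_gen (Edg i j) (Edg k l) \<longleftrightarrow> i < k \<or> i = k \<and> j \<le> l"

definition less_gen :: "'a gen \<Rightarrow> 'a gen \<Rightarrow> bool" where
  "less_gen x y \<longleftrightarrow> x \<le> y \<and> \<not> y \<le> x"

instance
proof
  fix x y z :: "'a gen"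
  show "x < y \<longleftrightarrow> x \<le> y \<and> \<not> y \<le> x" by (rule less_gen_def)
  show "x \<le> x" by (cases x) auto
  show "x \<le> z" if "x \<le> y" "y \<le> z"
    using that by (cases x; cases y; cases z) auto
  show "x = y" if "x \<le> y" "y \<le> x"
    using that by (cases x; cases y) auto
  show "x \<le> y \<or> y \<le> x" by (cases x; cases y) auto
qed

end

fun gen_vertices :: "'a gen \<Rightarrow> 'a set" where
  "gen_vertices (Vtx i) = {i}"
| "gen_vertices (Edg i j) = {i, j}"

definition gens :: "'a::linorder graph \<Rightarrow> 'a gen set" where
  "gens G = Vtx ` vertices G \<union> {Edg i j |i j. i < j \<and> {i, j} \<in> edges G}"


section \<open>The Dani-Mainkar Lie algebra\<close>

definition lin_ext :: "('k \<Rightarrow> 'v::real_vector) \<Rightarrow> ('k \<Rightarrow>\<^sub>0 real) \<Rightarrow> 'v" where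
  "lin_ext f p = (\<Sum>k\<in>Poly_Mapping.keys p. Poly_Mapping.lookup p k *\<^sub>R f k)"

definition dm_space :: "'a::linorder graph \<Rightarrow> ('a gen \<Rightarrow>\<^sub>0 real) set" where
  "dm_space G = {x. Poly_Mapping.keys x \<subseteq> gens G}"

fun dm_bracket_gen :: "'a::linorder graph \<Rightarrow> 'a gen \<Rightarrow> 'a gen \<Rightarrow> ('a gen \<Rightarrow>\<^sub>0 real)" where
  "dm_bracket_gen G (Vtx i) (Vtx j) =
     (if {i, j} \<in> edges G
      then if i < j then Poly_Mapping.single (Edg i j) 1
           else Poly_Mapping.single (Edg j i) (- 1)
      else 0)"
| "dm_bracket_gen G (Vtx i) (Edg k l) = 0"
| "dm_bracket_gen G (Edg i j) y = 0"

definition dm_bracket ::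
    "'a::linorder graph \<Rightarrow> ('a gen \<Rightarrow>\<^sub>0 real) \<Rightarrow> ('a gen \<Rightarrow>\<^sub>0 real) \<Rightarrow> ('a gen \<Rightarrow>\<^sub>0 real)" where
  "dm_bracket G x y = lin_ext (\<lambda>a. lin_ext (\<lambda>b. dm_bracket_gen G a b) y) x"


section \<open>Skew-commuting polynomials\<close>

text \<open>A finite set \<open>A\<close> of variables stands for the product of its elements in increasing order;
  a skew-commuting polynomial is a finite linear combination of such monomials.\<close>

type_synonym 'g skew_poly = "'g set \<Rightarrow>\<^sub>0 real"

definition mon :: "'g set \<Rightarrow> 'g skew_poly" where
  "mon A = Poly_Mapping.single A 1"

text \<open>The sign is that of the permutation sorting the concatenation of \<open>A\<close> and \<open>B\<close>.\<close>

definition mon_wedge :: "'g::linorder set \<Rightarrow> 'g set \<Rightarrow> 'g skew_poly" where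
  "mon_wedge A B =
     (if A \<inter> B = {} then (- 1) ^ card {(a, b). a \<in> A \<and> b \<in> B \<and> b < a} *\<^sub>R mon (A \<union> B) else 0)"

definition wedge :: "'g::linorder skew_poly \<Rightarrow> 'g skew_poly \<Rightarrow> 'g skew_poly" where
  "wedge p q = lin_ext (\<lambda>A. lin_ext (\<lambda>B. mon_wedge A B) q) p"

text \<open>The linear map sending a monomial $a_1 \cdots a_p$ (with $a_1 < \dots < a_p$) to
  $\sum_k (-1)^{k-1} a_1 \cdots a_{k-1}\, D(a_k)\, a_{k+1} \cdots a_p$, that is, the odd
  derivation with value \<open>D a\<close> on the variable \<open>a\<close>.\<close>

definition odd_derivation ::
    "('g::linorder \<Rightarrow> 'g skew_poly) \<Rightarrow> 'g skew_poly \<Rightarrow> 'g skew_poly" where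
  "odd_derivation D = lin_ext (\<lambda>A. \<Sum>a\<in>A. (- 1) ^ card {b\<in>A. b < a} *\<^sub>R
     wedge (wedge (mon {b\<in>A. b < a}) (D a)) (mon {b\<in>A. a < b}))"


section \<open>The Cartan-Chevalley-Eilenberg complex\<close>

text \<open>On dual basis vectors the differential is the transpose of the bracket,
  $Q(a^*) = \sum_{b<c} \langle a^*, [b,c]\rangle\, b^* c^*$ (sign convention without a minus).
  See \<open>dm_diff_Vtx\<close> and \<open>dm_diff_Edg\<close> below for its explicit values.\<close>

definition dm_diff_gen :: "'a::linorder graph \<Rightarrow> 'a gen \<Rightarrow> 'a gen skew_poly" where
  "dm_diff_gen G a = (\<Sum>(b, c)\<in>{(b, c). b \<in> gens G \<and> c \<in> gens G \<and> b < c}.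
     Poly_Mapping.lookup (dm_bracket G (Poly_Mapping.single b 1) (Poly_Mapping.single c 1)) a *\<^sub>R
       wedge (mon {b}) (mon {c}))"

definition dm_diff :: "'a::linorder graph \<Rightarrow> 'a gen skew_poly \<Rightarrow> 'a gen skew_poly" where
  "dm_diff G = odd_derivation (dm_diff_gen G)"

definition dm_cochains :: "'a::linorder graph \<Rightarrow> nat \<Rightarrow> 'a gen skew_poly set" where
  "dm_cochains G i = span {mon A |A. A \<subseteq> gens G \<and> card A = i}"

definition support_cochains ::
    "'a::linorder graph \<Rightarrow> 'a set \<Rightarrow> nat \<Rightarrow> 'a gen skew_poly set" where
  "support_cochains G S i =
     span {mon A |A. A \<subseteq> gens G \<and> card A = i \<and> (\<Union>a\<in>A. gen_vertices a) = S}"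

text \<open>\<open>support_cochains G {}\<close> consists of the constants, in degree 0. The convention
  $\mathcal{C}^\bullet(G,\emptyset) = 0$ is imposed separately.\<close>

definition dm_subcomplex ::
    "'a::linorder graph \<Rightarrow> 'a set \<Rightarrow> nat \<Rightarrow> 'a gen skew_poly set" where
  "dm_subcomplex G S i = (if S = {} then {0} else support_cochains G S i)"


section \<open>Quotients, direct sums and dimension of real vector spaces\<close>

record 'v vs =
  carr :: "'v set"
  vzero :: 'v
  vadd :: "'v \<Rightarrow> 'v \<Rightarrow> 'v"
  vscale :: "real \<Rightarrow> 'v \<Rightarrow> 'v"

definition vs_quotient :: "'v::real_vector set \<Rightarrow> 'v set \<Rightarrow> 'v set vs" where
  "vs_quotient Z B =
     \<lparr>carr = {{z + b |b. b \<in> B} |z. z \<in> Z},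
      vzero = B,
      vadd = (\<lambda>X Y. {x + y |x y. x \<in> X \<and> y \<in> Y}),
      vscale = (\<lambda>c X. {c *\<^sub>R x + b |x b. x \<in> X \<and> b \<in> B})\<rparr>"

text \<open>Only used for finite \<open>I\<close>, where product and direct sum agree.\<close>

definition vs_direct_sum :: "'i set \<Rightarrow> ('i \<Rightarrow> 'v vs) \<Rightarrow> ('i \<Rightarrow> 'v) vs" where
  "vs_direct_sum I F =
     \<lparr>carr = (\<Pi>\<^sub>E s\<in>I. carr (F s)),
      vzero = (\<lambda>s\<in>I. vzero (F s)),
      vadd = (\<lambda>x y. \<lambda>s\<in>I. vadd (F s) (x s) (y s)),
      vscale = (\<lambda>c x. \<lambda>s\<in>I. vscale (F s) c (x s))\<rparr>"

definition vs_iso :: "('v \<Rightarrow> 'w) \<Rightarrow> 'v vs \<Rightarrow> 'w vs \<Rightarrow> bool" where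
  "vs_iso f V W \<longleftrightarrow>
     bij_betw f (carr V) (carr W) \<and>
     (\<forall>x\<in>carr V. \<forall>y\<in>carr V. f (vadd V x y) = vadd W (f x) (f y)) \<and>
     (\<forall>c. \<forall>x\<in>carr V. f (vscale V c x) = vscale W c (f x))"

fun vs_lincomb :: "'v vs \<Rightarrow> nat \<Rightarrow> (nat \<Rightarrow> real) \<Rightarrow> (nat \<Rightarrow> 'v) \<Rightarrow> 'v" where
  "vs_lincomb V 0 c v = vzero V"
| "vs_lincomb V (Suc n) c v = vadd V (vs_lincomb V n c v) (vscale V (c n) (v n))"

definition vs_basis :: "'v vs \<Rightarrow> nat \<Rightarrow> (nat \<Rightarrow> 'v) \<Rightarrow> bool" where
  "vs_basis V n v \<longleftrightarrow>
     (\<forall>k<n. v k \<in> carr V) \<and>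
     (\<forall>x\<in>carr V. \<exists>!c. c \<in> {..<n} \<rightarrow>\<^sub>E UNIV \<and> x = vs_lincomb V n c v)"

definition vs_dim :: "'v vs \<Rightarrow> nat" where
  "vs_dim V = (THE n. \<exists>v. vs_basis V n v)"


section \<open>Cohomology\<close>

definition coboundaries :: "(nat \<Rightarrow> 'v::real_vector set) \<Rightarrow> ('v \<Rightarrow> 'v) \<Rightarrow> nat \<Rightarrow> 'v set" where
  "coboundaries C d i = (case i of 0 \<Rightarrow> {0} | Suc j \<Rightarrow> d ` C j)"

definition cohomology :: "(nat \<Rightarrow> 'v::real_vector set) \<Rightarrow> ('v \<Rightarrow> 'v) \<Rightarrow> nat \<Rightarrow> 'v set vs" where
  "cohomology C d i = vs_quotient {z \<in> C i. d z = 0} (coboundaries C d i)"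

definition lie_cohomology :: "'a::linorder graph \<Rightarrow> nat \<Rightarrow> 'a gen skew_poly set vs" where
  "lie_cohomology G = cohomology (dm_cochains G) (dm_diff G)"

definition essential_cohomology :: "'a::linorder graph \<Rightarrow> nat \<Rightarrow> 'a gen skew_poly set vs" where
  "essential_cohomology H = cohomology (dm_subcomplex H (vertices H)) (dm_diff H)"

text \<open>With the convention for the empty vertex set, no essential cohomology lives in degree 0,
  whereas the cohomology of the Lie algebra has the class of the constant 1 there. Without the
  convention the graph without vertices contributes exactly this class; nothing else changes.\<close>

definition unital_essential_cohomology ::
    "'a::linorder graph \<Rightarrow> nat \<Rightarrow> 'a gen skew_poly set vs" where
  "unital_essential_cohomology H = cohomology (support_cochains H (vertices H)) (dm_diff H)"

definition betti :: "'a::linorder graph \<Rightarrow> nat \<Rightarrow> nat" where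
  "betti G i = vs_dim (lie_cohomology G i)"

definition essential_betti :: "'a::linorder graph \<Rightarrow> nat \<Rightarrow> nat" where
  "essential_betti H i = vs_dim (essential_cohomology H i)"

definition unital_essential_betti :: "'a::linorder graph \<Rightarrow> nat \<Rightarrow> nat" where
  "unital_essential_betti H i = vs_dim (unital_essential_cohomology H i)"

text \<open>The polynomials of all induced subgraphs of \<open>G\<close> live in one type, so the chain map sending
  each monomial to itself is the identity. A family of classes $[z_S]$ is sent to the class of
  $\sum_S z_S$, written as the union over all choices of representatives; that this union
  is a single class is part of \<open>vs_iso\<close>.\<close>

definition canonical_map ::
    "'a::linorder graph \<Rightarrow> nat \<Rightarrow> ('a set \<Rightarrow> 'a gen skew_poly set) \<Rightarrow> 'a gen skew_poly set" where
  "canonical_map G i \<xi> =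
     {(\<Sum>S\<in>Pow (vertices G). z S) + b |z b.
        (\<forall>S\<in>Pow (vertices G). z S \<in> \<xi> S) \<and> b \<in> coboundaries (dm_cochains G) (dm_diff G) i}"


section \<open>The Lie algebra axioms and explicit values of the differential\<close>

lemma lookup_scaleR: "Poly_Mapping.lookup (c *\<^sub>R p) k = c *\<^sub>R Poly_Mapping.lookup p k"
proof -
  have "finite {i. c *\<^sub>R Poly_Mapping.lookup p i \<noteq> 0}"
    by (rule finite_subset[OF _ finite_keys[of p]]) (auto simp: in_keys_iff)
  then show ?thesis by (simp add: scaleR_poly_mapping_def)
qed

lemma lin_ext_single [simp]: "lin_ext f (Poly_Mapping.single k c) = c *\<^sub>R f k"
  by (cases "c = 0") (auto simp: lin_ext_def)

lemma lin_ext_mon [simp]: "lin_ext mon p = p"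
proof (rule poly_mapping_eqI)
  fix k
  have "Poly_Mapping.lookup (lin_ext mon p) k =
      (\<Sum>l\<in>Poly_Mapping.keys p. if k = l then Poly_Mapping.lookup p k else 0)"
    unfolding lin_ext_def lookup_sum
    by (rule sum.cong) (auto simp: lookup_scaleR mon_def lookup_single)
  then show "Poly_Mapping.lookup (lin_ext mon p) k = Poly_Mapping.lookup p k"
    by (simp add: in_keys_iff)
qed

lemma lin_ext_zero: "(\<And>k. k \<in> Poly_Mapping.keys p \<Longrightarrow> f k = 0) \<Longrightarrow> lin_ext f p = 0"
  by (simp add: lin_ext_def)

lemma dm_bracket_gen_skew:
  assumes "simple_graph G"
  shows "dm_bracket_gen G b a = - dm_bracket_gen G a b"
proof (cases "\<exists>i j. a = Vtx i \<and> b = Vtx j")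
  case True
  then obtain i j where ab: "a = Vtx i" "b = Vtx j" by blast
  have swap: "{j, i} = {i, j}" by (rule insert_commute)
  show ?thesis
  proof (cases "{i, j} \<in> edges G")
    case True
    then have "i \<noteq> j" using assms by (auto simp: simple_graph_def)
    with True show ?thesis
      by (cases i j rule: linorder_cases) (auto simp: ab swap single_uminus dest: less_asym)
  next
    case False
    then show ?thesis by (simp add: ab swap)
  qed
next
  case False
  then show ?thesis by (cases a; cases b) simp_all
qed

lemma dm_bracket_skew:
  assumes "simple_graph G"
  shows "dm_bracket G y x = - dm_bracket G x y"
proof -
  have neg: "s *\<^sub>R t *\<^sub>R dm_bracket_gen G b a = - (t *\<^sub>R s *\<^sub>R dm_bracket_gen G a b)"
    for s t a b
    by (subst dm_bracket_gen_skew[OF assms]) (simp add: mult.commute)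
  have "dm_bracket G y x = (\<Sum>b\<in>Poly_Mapping.keys y. \<Sum>a\<in>Poly_Mapping.keys x.
      - (Poly_Mapping.lookup x a *\<^sub>R Poly_Mapping.lookup y b *\<^sub>R dm_bracket_gen G a b))"
    unfolding dm_bracket_def lin_ext_def scaleR_sum_right by (intro sum.cong refl neg)
  also have "\<dots> = (\<Sum>a\<in>Poly_Mapping.keys x. \<Sum>b\<in>Poly_Mapping.keys y.
      - (Poly_Mapping.lookup x a *\<^sub>R Poly_Mapping.lookup y b *\<^sub>R dm_bracket_gen G a b))"
    by (rule sum.swap)
  also have "\<dots> = - dm_bracket G x y"
    unfolding dm_bracket_def lin_ext_def scaleR_sum_right sum_negf ..
  finally show ?thesis .
qed

lemma keys_dm_bracket:
  assumes "simple_graph G"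
  shows "Poly_Mapping.keys (dm_bracket G x y) \<subseteq> range (case_prod Edg) \<inter> gens G"
proof -
  have gen: "Poly_Mapping.keys (dm_bracket_gen G a b) \<subseteq> range (case_prod Edg) \<inter> gens G" for a b
  proof (cases a; cases b)
    fix i j assume ab: "a = Vtx i" "b = Vtx j"
    have "i \<noteq> j" if "{i, j} \<in> edges G"
      using assms that by (auto simp: simple_graph_def)
    then show ?thesis
      using insert_commute[of i j "{}"] by (cases "i < j") (auto simp: ab gens_def)
  qed auto
  have "Poly_Mapping.lookup (dm_bracket G x y) k = 0"
    if "k \<notin> range (case_prod Edg) \<inter> gens G" for k
  proof -
    have "Poly_Mapping.lookup (dm_bracket_gen G a b) k = 0" for a b
      using gen[of a b] that by (meson in_keys_iff subsetD)
    then show ?thesis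
      by (simp add: dm_bracket_def lin_ext_def lookup_sum lookup_scaleR)
  qed
  then show ?thesis by (meson in_keys_iff subsetI)
qed

lemma dm_bracket_in_dm_space: "simple_graph G \<Longrightarrow> dm_bracket G x y \<in> dm_space G"
  using keys_dm_bracket[of G x y] unfolding dm_space_def by blast

text \<open>Two-step nilpotency; the Jacobi identity is an immediate consequence.\<close>

lemma dm_bracket_nilpotent:
  assumes "simple_graph G"
  shows "dm_bracket G x (dm_bracket G y z) = 0"
proof -
  have "dm_bracket_gen G a b = 0" if "b \<in> Poly_Mapping.keys (dm_bracket G y z)" for a b
    using keys_dm_bracket[OF assms, of y z] that by (cases a) auto
  then show ?thesis
    unfolding dm_bracket_def[of G x] by (simp add: lin_ext_zero)
qed

lemma dm_bracket_single [simp]: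
  "dm_bracket G (Poly_Mapping.single a 1) (Poly_Mapping.single b 1) = dm_bracket_gen G a b"
  by (simp add: dm_bracket_def)

lemma wedge_mon [simp]: "wedge (mon A) (mon B) = mon_wedge A B"
  by (simp add: wedge_def mon_def)

lemma wedge_one [simp]: "wedge (mon {}) p = p" "wedge p (mon {}) = p"
  by (simp_all add: wedge_def mon_def[of "{}"] mon_wedge_def)

lemma odd_derivation_var: "odd_derivation D (mon {a}) = D a"
proof -
  have e: "{b \<in> {a}. b < a} = {}" "{b \<in> {a}. a < b} = {}" by auto
  have "odd_derivation D (mon {a}) = (- 1) ^ card {b \<in> {a}. b < a} *\<^sub>R
      wedge (wedge (mon {b \<in> {a}. b < a}) (D a)) (mon {b \<in> {a}. a < b})"
    unfolding odd_derivation_def mon_def[of "{a}"] lin_ext_single by simp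
  then show ?thesis unfolding e by simp
qed

lemma dm_diff_Vtx: "dm_diff G (mon {Vtx i}) = 0"
proof -
  have "Poly_Mapping.lookup (dm_bracket_gen G b c) (Vtx i) = 0" for b c
    by (cases b; cases c) (auto simp: lookup_single)
  then show ?thesis by (simp add: dm_diff_def odd_derivation_var dm_diff_gen_def)
qed

lemma dm_diff_Edg:
  assumes "simple_graph G" "{i, j} \<in> edges G" "i < j"
  shows "dm_diff G (mon {Edg i j}) = wedge (mon {Vtx i}) (mon {Vtx j})"
proof -
  let ?P = "{(b, c). b \<in> gens G \<and> c \<in> gens G \<and> b < c}"
  have sub: "e \<subseteq> vertices G" if "e \<in> edges G" for e
    using assms(1) that by (auto simp: simple_graph_def)
  have "gens G \<subseteq> Vtx ` vertices G \<union> case_prod Edg ` (vertices G \<times> vertices G)"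
    using sub by (fastforce simp: gens_def)
  moreover have "finite (vertices G)"
    using assms(1) by (simp add: simple_graph_def)
  ultimately have finG: "finite (gens G)"
    by (simp add: finite_subset)
  have fin: "finite ?P"
    by (rule finite_subset[of _ "gens G \<times> gens G"]) (auto simp: finG)
  have mem: "(Vtx i, Vtx j) \<in> ?P"
    using sub[OF assms(2)] assms(3) by (auto simp: gens_def less_gen_def)
  have zero: "Poly_Mapping.lookup (dm_bracket_gen G b c) (Edg i j) = 0"
    if "(b, c) \<in> ?P - {(Vtx i, Vtx j)}" for b c
  proof (cases "\<exists>k l. b = Vtx k \<and> c = Vtx l")
    case True
    then obtain k l where bc: "b = Vtx k" "c = Vtx l" by blast
    then have "k < l" "Edg k l \<noteq> Edg i j"
      using that by (auto simp: less_gen_def)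
    then show ?thesis by (simp add: bc lookup_single)
  next
    case False
    then have "dm_bracket_gen G b c = 0" by (cases b; cases c) simp_all
    then show ?thesis by simp
  qed
  have "dm_diff G (mon {Edg i j}) =
      (\<Sum>(b, c)\<in>{(Vtx i, Vtx j)}. Poly_Mapping.lookup (dm_bracket_gen G b c) (Edg i j) *\<^sub>R
        wedge (mon {b}) (mon {c}))"
    unfolding dm_diff_def odd_derivation_var dm_diff_gen_def dm_bracket_single
  proof (rule sum.mono_neutral_right[OF fin])
    show "\<forall>x\<in>?P - {(Vtx i, Vtx j)}. (case x of (b, c) \<Rightarrow>
        Poly_Mapping.lookup (dm_bracket_gen G b c) (Edg i j) *\<^sub>R wedge (mon {b}) (mon {c})) = 0"
    proof
      fix x assume "x \<in> ?P - {(Vtx i, Vtx j)}"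
      moreover obtain b c where "x = (b, c)" by (cases x)
      ultimately show "(case x of (b, c) \<Rightarrow>
        Poly_Mapping.lookup (dm_bracket_gen G b c) (Edg i j) *\<^sub>R wedge (mon {b}) (mon {c})) = 0"
        using zero[of b c] by (simp only: prod.case scaleR_zero_left)
    qed
  qed (use mem in simp)
  then show ?thesis using assms(2,3) by simp
qed

end

theory Submission
  imports Defs
begin

text \<open>Replacing a variable $x_{i,j}^*$ by $x_i^* x_j^*$ does not change the set of vertices
  occurring in a monomial. Hence the complex is the direct sum, over all sets $S$ of vertices, of
  the subcomplexes spanned by the monomials with vertex set $S$, and the summand for $S$ only
  involves the induced subgraph on $S$. Cocycles and coboundaries, and therefore the quotients,
  split accordingly. Dimensions add up because complements of the coboundaries in the cocycles,
  chosen in each summand, together form such a complement in the whole complex.\<close>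

section \<open>Dimension of abstract vector spaces\<close>

text \<open>Cohomology is a record whose elements are cosets, so \<open>dim\<close> does not apply
  to it directly. The bridge is a linear bijection from an honest subspace \<open>W\<close> onto the
  carrier, namely \<open>coset B\<close> restricted to a complement of the coboundaries. Since
  \<open>vs_dim\<close> is a definite description, existence of a basis and uniqueness of its length
  both have to be carried across this bijection. Independence of the summands enters in two degrees:
  in degree \<open>i\<close> to compare components of cocycles and coboundaries, and in degree
  \<open>Suc i\<close> to see that the components of a cocycle are themselves cocycles. The constant
  monomial has empty vertex set and needs a summand of its own. The decomposition is therefore
  proved for the unital version in all degrees, and the convention for the empty set is dealt with
  afterwards, in positive degree.\<close>

lemma vs_lincomb_image:
  fixes \<phi> :: "'v::real_vector \<Rightarrow> 'w"
  assumes W: "subspace W"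
    and zero: "\<phi> 0 = vzero V"
    and add: "\<And>x y. x \<in> W \<Longrightarrow> y \<in> W \<Longrightarrow> \<phi> (x + y) = vadd V (\<phi> x) (\<phi> y)"
    and scale: "\<And>c x. x \<in> W \<Longrightarrow> \<phi> (c *\<^sub>R x) = vscale V c (\<phi> x)"
    and w: "\<And>k. k < n \<Longrightarrow> w k \<in> W" and v: "\<And>k. k < n \<Longrightarrow> v k = \<phi> (w k)"
  shows "vs_lincomb V n c v = \<phi> (\<Sum>k<n. c k *\<^sub>R w k)"
  using w v
proof (induction n)
  case 0
  then show ?case by (simp add: zero)
next
  case (Suc n)
  \<comment> \<open>\<open>\<phi>\<close> is known to be additive only on \<open>W\<close>, so both
    summands must be placed in \<open>W\<close> before \<open>add\<close> applies.\<close>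
  have "(\<Sum>k<n. c k *\<^sub>R w k) \<in> W"
    by (intro subspace_sum[OF W] subspace_scale[OF W] Suc.prems(1)) simp
  moreover have "c n *\<^sub>R w n \<in> W"
    by (intro subspace_scale[OF W] Suc.prems(1)) simp
  ultimately show ?case
    using Suc by (simp add: add scale)
qed

text \<open>A basis of the record is pulled back along \<open>\<phi>\<close> to a family
  \<open>w\<close> in \<open>W\<close>, where unique representation becomes ordinary independence
  and spanning. This settles the uniqueness half of the definite description in
  \<open>vs_dim\<close>.\<close>

lemma vs_basis_card:
  fixes \<phi> :: "'v::real_vector \<Rightarrow> 'w"
  assumes W: "subspace W"
    and bij: "bij_betw \<phi> W (carr V)"
    and zero: "\<phi> 0 = vzero V"
    and add: "\<And>x y. x \<in> W \<Longrightarrow> y \<in> W \<Longrightarrow> \<phi> (x + y) = vadd V (\<phi> x) (\<phi> y)"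
    and scale: "\<And>c x. x \<in> W \<Longrightarrow> \<phi> (c *\<^sub>R x) = vscale V c (\<phi> x)"
    and basis: "vs_basis V n v"
  shows "n = dim W"
proof -
  have inj: "inj_on \<phi> W" and surj: "\<phi> ` W = carr V"
    using bij by (auto simp: bij_betw_def)
  define w where "w k = inv_into W \<phi> (v k)" for k
  have vc: "v k \<in> \<phi> ` W" if "k < n" for k
    using basis that by (auto simp: vs_basis_def surj)
  have wW: "w k \<in> W" if "k < n" for k
    unfolding w_def by (rule inv_into_into[OF vc[OF that]])
  have vw: "v k = \<phi> (w k)" if "k < n" for k
    unfolding w_def by (rule f_inv_into_f[OF vc[OF that], symmetric])
  have comb: "vs_lincomb V n c v = \<phi> (\<Sum>k<n. c k *\<^sub>R w k)" for c
    by (rule vs_lincomb_image[where \<phi> = \<phi> and W = W and w = w, OF W zero add scale wW vw])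
  have combW: "(\<Sum>k<n. c k *\<^sub>R w k) \<in> W" for c
    by (intro subspace_sum[OF W] subspace_scale[OF W] wW) simp
  have rep: "\<exists>!c. c \<in> {..<n} \<rightarrow>\<^sub>E UNIV \<and> x = (\<Sum>k<n. c k *\<^sub>R w k)" if "x \<in> W" for x
  proof -
    have "\<phi> x \<in> carr V" using that surj by blast
    then have "\<exists>!c. c \<in> {..<n} \<rightarrow>\<^sub>E UNIV \<and> \<phi> x = \<phi> (\<Sum>k<n. c k *\<^sub>R w k)"
      using basis unfolding vs_basis_def comb by blast
    moreover have "\<phi> x = \<phi> (\<Sum>k<n. c k *\<^sub>R w k) \<longleftrightarrow> x = (\<Sum>k<n. c k *\<^sub>R w k)" for c
      using inj_on_eq_iff[OF inj that combW] .
    ultimately show ?thesis by simp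
  qed
  have indep: "c k = 0" if "(\<Sum>k<n. c k *\<^sub>R w k) = 0" "k < n" for c k
  proof -
    \<comment> \<open>Uniqueness is applied to the zero vector. Coefficient functions are
      \<open>undefined\<close> outside \<open>{..<n}\<close>, so \<open>c\<close> and the zero
      function are restricted before they are identified.\<close>
    obtain d where d: "\<And>c'. c' \<in> {..<n} \<rightarrow>\<^sub>E UNIV \<Longrightarrow> (\<Sum>k<n. c' k *\<^sub>R w k) = 0 \<Longrightarrow> c' = d"
      using rep[OF subspace_0[OF W]] by metis
    have "restrict c {..<n} = d" "restrict (\<lambda>_. 0) {..<n} = d"
      by (rule d; use that(1) in simp)+
    then have "restrict c {..<n} k = restrict (\<lambda>_. 0) {..<n} k" by simp
    then show ?thesis using that(2) by simp
  qed
  have injw: "inj_on w {..<n}"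
  proof (rule inj_onI, rule ccontr)
    fix a b assume ab: "a \<in> {..<n}" "b \<in> {..<n}" "w a = w b" "a \<noteq> b"
    \<comment> \<open>Coefficients 1 at \<open>a\<close> and -1 at \<open>b\<close> give a
      nontrivial relation. This needs its own argument because \<open>independent\<close> speaks of
      sets and would not notice a repeated vector.\<close>
    have "(\<Sum>k<n. (if k = a then 1 else if k = b then -1 else 0) *\<^sub>R w k)
        = (\<Sum>k<n. (if k = a then w a else 0) - (if k = b then w b else 0))"
      by (rule sum.cong) (use ab in auto)
    also have "\<dots> = 0"
      using ab by (simp add: sum_subtractf)
    finally show False using indep[of "\<lambda>k. if k = a then 1 else if k = b then -1 else 0" a] ab
      by simp
  qed
  have "independent (w ` {..<n})"
  proof (rule independent_if_scalars_zero)
    fix f x assume f: "(\<Sum>x\<in>w ` {..<n}. f x *\<^sub>R x) = 0" and x: "x \<in> w ` {..<n}"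
    have "(\<Sum>k<n. f (w k) *\<^sub>R w k) = 0"
      using f by (simp add: sum.reindex[OF injw])
    then show "f x = 0" using indep[of "\<lambda>k. f (w k)"] x by auto
  qed simp
  moreover have "W \<subseteq> span (w ` {..<n})"
  proof
    fix x assume "x \<in> W"
    then obtain c where "x = (\<Sum>k<n. c k *\<^sub>R w k)" using rep by blast
    then show "x \<in> span (w ` {..<n})"
      by (auto intro!: span_sum span_scale intro: span_base)
  qed
  moreover have "w ` {..<n} \<subseteq> W" using wW by auto
  ultimately have "dim W = n"
    by (intro dim_unique) (auto simp: card_image[OF injw])
  then show ?thesis by simp
qed

text \<open>The image of a basis of \<open>W\<close> is a basis of the record, and
  \<open>vs_basis_card\<close> fixes the length of every other one. The finite set \<open>F\<close>
  makes bases of \<open>W\<close> finite, as \<open>vs_basis\<close> only has finite index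
  sets.\<close>

lemma vs_dim_eq_dim:
  fixes \<phi> :: "'v::real_vector \<Rightarrow> 'w"
  assumes W: "subspace W" and fin: "finite F" "W \<subseteq> span F"
    and bij: "bij_betw \<phi> W (carr V)"
    and zero: "\<phi> 0 = vzero V"
    and add: "\<And>x y. x \<in> W \<Longrightarrow> y \<in> W \<Longrightarrow> \<phi> (x + y) = vadd V (\<phi> x) (\<phi> y)"
    and scale: "\<And>c x. x \<in> W \<Longrightarrow> \<phi> (c *\<^sub>R x) = vscale V c (\<phi> x)"
  shows "vs_dim V = dim W"
proof -
  have inj: "inj_on \<phi> W" and surj: "\<phi> ` W = carr V"
    using bij by (auto simp: bij_betw_def)
  obtain K where K: "K \<subseteq> W" "independent K" "W \<subseteq> span K" "card K = dim W"
    using basis_exists by blast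
  have finK: "finite K"
    using independent_span_bound[OF fin(1) K(2)] K(1) fin(2) by blast
  define n where "n = dim W"
  obtain h where h: "bij_betw h {..<n} K"
    using ex_bij_betw_nat_finite[OF finK] K(4) by (auto simp: n_def atLeast0LessThan)
  have hW: "h k \<in> W" if "k < n" for k
    using h K(1) that by (auto simp: bij_betw_def)
  have comb: "vs_lincomb V n c (\<phi> \<circ> h) = \<phi> (\<Sum>k<n. c k *\<^sub>R h k)" for c
    by (rule vs_lincomb_image[where \<phi> = \<phi> and W = W and w = h, OF W zero add scale hW]) auto
  have combW: "(\<Sum>k<n. c k *\<^sub>R h k) \<in> W" for c
    by (intro subspace_sum[OF W] subspace_scale[OF W] hW) simp
  have inv: "inv_into {..<n} h (h k) = k" if "k < n" for k
    using h that by (auto simp: bij_betw_def)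
  have "vs_basis V n (\<phi> \<circ> h)"
    unfolding vs_basis_def
  proof (intro conjI allI impI ballI)
    fix k assume "k < n"
    then show "(\<phi> \<circ> h) k \<in> carr V" using hW surj by auto
  next
    fix y assume "y \<in> carr V"
    then obtain x where x: "x \<in> W" "y = \<phi> x" using surj by auto
    have eq: "y = vs_lincomb V n c (\<phi> \<circ> h) \<longleftrightarrow> x = (\<Sum>k<n. c k *\<^sub>R h k)" for c
      using inj_on_eq_iff[OF inj x(1) combW] by (simp add: comb x(2))
    obtain u where u: "x = (\<Sum>v\<in>K. u v *\<^sub>R v)"
      using x(1) K(3) span_finite[OF finK] by auto
    have xu: "x = (\<Sum>k<n. restrict (u \<circ> h) {..<n} k *\<^sub>R h k)"
      unfolding u sum.reindex_bij_betw[OF h, symmetric] by simp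
    show "\<exists>!c. c \<in> {..<n} \<rightarrow>\<^sub>E UNIV \<and> y = vs_lincomb V n c (\<phi> \<circ> h)"
      unfolding eq
    proof (rule ex1I[of _ "restrict (u \<circ> h) {..<n}"])
      show "restrict (u \<circ> h) {..<n} \<in> {..<n} \<rightarrow>\<^sub>E UNIV \<and>
          x = (\<Sum>k<n. restrict (u \<circ> h) {..<n} k *\<^sub>R h k)"
        using xu by auto
      fix c assume c: "c \<in> {..<n} \<rightarrow>\<^sub>E UNIV \<and> x = (\<Sum>k<n. c k *\<^sub>R h k)"
      \<comment> \<open>Independence of \<open>K\<close> is about coefficients indexed by vectors,
        so the difference of the two coefficient families is carried from \<open>{..<n}\<close> to
        \<open>K\<close> by the inverse of \<open>h\<close>.\<close>
      let ?g = "\<lambda>v. c (inv_into {..<n} h v) - u v"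
      have "(\<Sum>v\<in>K. ?g v *\<^sub>R v) = (\<Sum>k<n. ?g (h k) *\<^sub>R h k)"
        by (rule sum.reindex_bij_betw[OF h, symmetric])
      also have "\<dots> = (\<Sum>k<n. c k *\<^sub>R h k) - (\<Sum>k<n. u (h k) *\<^sub>R h k)"
        unfolding sum_subtractf[symmetric]
        by (rule sum.cong) (auto simp: inv scaleR_diff_left)
      also have "\<dots> = 0" using c xu by simp
      finally have z: "(\<Sum>v\<in>K. ?g v *\<^sub>R v) = 0" .
      show "c = restrict (u \<circ> h) {..<n}"
      proof (rule PiE_ext)
        show "c \<in> {..<n} \<rightarrow>\<^sub>E UNIV" using c by simp
        show "restrict (u \<circ> h) {..<n} \<in> {..<n} \<rightarrow>\<^sub>E UNIV" by simp
        fix k assume k: "k \<in> {..<n}"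
        have "?g (h k) = 0"
          by (rule independentD[OF K(2) finK subset_refl z])
            (use h k in \<open>auto simp: bij_betw_def\<close>)
        then show "c k = restrict (u \<circ> h) {..<n} k" using k by (simp add: inv)
      qed
    qed
  qed
  moreover have "m = n" if "vs_basis V m v" for m v
    unfolding n_def
    by (rule vs_basis_card[where \<phi> = \<phi> and W = W and V = V, OF W bij zero add scale that])
  ultimately show ?thesis
    unfolding vs_dim_def n_def[symmetric] by (intro the_equality) blast+
qed

text \<open>A basis \<open>K\<close> of \<open>Z \<inter> B\<close> is extended to a basis
  \<open>L\<close> of \<open>Z\<close>; the new vectors span the complement.\<close>

lemma complement_mod_subspace:
  fixes Z B :: "'v::real_vector set"
  assumes Z: "subspace Z" and B: "subspace B"
  obtains W where "subspace W" "W \<subseteq> Z" "W \<inter> B \<subseteq> {0}" "\<And>z. z \<in> Z \<Longrightarrow> \<exists>w\<in>W. z - w \<in> B"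
proof -
  obtain K where K: "K \<subseteq> Z \<inter> B" "independent K" "Z \<inter> B \<subseteq> span K"
    using basis_exists[of "Z \<inter> B"] by metis
  obtain L where L: "K \<subseteq> L" "L \<subseteq> Z" "independent L" "Z \<subseteq> span L"
    using maximal_independent_subset_extend[of K Z] K(1,2) by (metis le_inf_iff)
  \<comment> \<open>\<open>g\<close> is the identity on \<open>span K\<close> and zero on
    \<open>span (L - K)\<close>, so a vector common to both spans is zero.\<close>
  obtain g where g: "linear g" "\<And>x. x \<in> L \<Longrightarrow> g x = (if x \<in> K then x else 0)"
    using linear_independent_extend[OF L(3), of "\<lambda>x. if x \<in> K then x else 0"] by blast
  have gK: "g x = x" if "x \<in> span K" for x
  proof -
    have "g y = id y" if "y \<in> K" for y using g(2)[of y] L(1) that by auto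
    from linear_eq_on_span[OF g(1) linear_id this \<open>x \<in> span K\<close>] show ?thesis by simp
  qed
  have gW: "g x = 0" if "x \<in> span (L - K)" for x
  proof -
    have "g y = 0" if "y \<in> L - K" for y using g(2)[of y] that by auto
    from linear_eq_on_span[OF g(1) linear_zero this \<open>x \<in> span (L - K)\<close>] show ?thesis .
  qed
  have sub: "span (L - K) \<subseteq> Z"
    using L(2) by (intro span_minimal[OF _ Z]) auto
  show thesis
  proof (rule that[of "span (L - K)"])
    show "span (L - K) \<inter> B \<subseteq> {0}"
    proof
      fix x assume x: "x \<in> span (L - K) \<inter> B"
      then have "x \<in> span K" using sub K(3) by blast
      then show "x \<in> {0}" using gK[of x] gW[of x] x by simp
    qed
    fix z assume "z \<in> Z"
    then have "z \<in> span ((L - K) \<union> K)"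
      using L(1,4) by (auto simp: Un_absorb2)
    then obtain w b where "w \<in> span (L - K)" "b \<in> span K" "z = w + b"
      unfolding span_Un by blast
    moreover have "span K \<subseteq> B"
      using K(1) by (intro span_minimal[OF _ B]) auto
    ultimately show "\<exists>w\<in>span (L - K). z - w \<in> B" by force
  qed (use sub in auto)
qed


section \<open>Internal direct sums\<close>

text \<open>For infinite \<open>I\<close> every \<open>sum\<close> over \<open>I\<close> is 0, so
  this and \<open>indep_family\<close> have their usual meaning for finite \<open>I\<close>.\<close>

definition sum_space :: "'i set \<Rightarrow> ('i \<Rightarrow> 'v::real_vector set) \<Rightarrow> 'v set" where
  "sum_space I U = {\<Sum>s\<in>I. x s |x. \<forall>s\<in>I. x s \<in> U s}"

definition indep_family :: "'i set \<Rightarrow> ('i \<Rightarrow> 'v::real_vector set) \<Rightarrow> bool" where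
  "indep_family I U \<longleftrightarrow>
     (\<forall>x. (\<forall>s\<in>I. x s \<in> U s) \<longrightarrow> (\<Sum>s\<in>I. x s) = 0 \<longrightarrow> (\<forall>s\<in>I. x s = 0))"

lemma sum_spaceI: "(\<And>s. s \<in> I \<Longrightarrow> x s \<in> U s) \<Longrightarrow> (\<Sum>s\<in>I. x s) \<in> sum_space I U"
  by (auto simp: sum_space_def)

lemma sum_spaceE:
  assumes "y \<in> sum_space I U"
  obtains x where "\<And>s. s \<in> I \<Longrightarrow> x s \<in> U s" "y = (\<Sum>s\<in>I. x s)"
  using assms by (auto simp: sum_space_def)

lemma indep_familyD:
  "indep_family I U \<Longrightarrow> (\<And>s. s \<in> I \<Longrightarrow> x s \<in> U s) \<Longrightarrow> (\<Sum>s\<in>I. x s) = 0 \<Longrightarrow> s \<in> I \<Longrightarrow> x s = 0"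
  by (auto simp: indep_family_def)

lemma indep_family_mono:
  "indep_family I U \<Longrightarrow> (\<And>s. s \<in> I \<Longrightarrow> W s \<subseteq> U s) \<Longrightarrow> indep_family I W"
  unfolding indep_family_def by blast

lemma indep_family_eq:
  assumes "indep_family I U" "\<And>s. s \<in> I \<Longrightarrow> subspace (U s)"
    and "\<And>s. s \<in> I \<Longrightarrow> x s \<in> U s" "\<And>s. s \<in> I \<Longrightarrow> y s \<in> U s"
    and "(\<Sum>s\<in>I. x s) = (\<Sum>s\<in>I. y s)" "s \<in> I"
  shows "x s = y s"
  using indep_familyD[OF assms(1), of "\<lambda>s. x s - y s" s] assms(2-)
  by (auto simp: sum_subtractf intro: subspace_diff)

lemma subspace_sum_space:
  assumes "\<And>s. s \<in> I \<Longrightarrow> subspace (U s)"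
  shows "subspace (sum_space I U)"
proof (rule subspaceI)
  show "0 \<in> sum_space I U"
    using sum_spaceI[of I "\<lambda>_. 0" U] assms by (simp add: subspace_0)
next
  fix x y assume "x \<in> sum_space I U" "y \<in> sum_space I U"
  then show "x + y \<in> sum_space I U"
    by (elim sum_spaceE) (auto simp: sum.distrib[symmetric] intro!: sum_spaceI subspace_add[OF assms])
next
  fix c :: real and x assume "x \<in> sum_space I U"
  then show "c *\<^sub>R x \<in> sum_space I U"
    by (elim sum_spaceE) (auto simp: scaleR_sum_right intro!: sum_spaceI subspace_scale[OF assms])
qed

text \<open>This is what turns the coboundaries of the whole complex into the sum of the
  coboundaries of the summands.\<close>

lemma sum_space_linear_image:
  assumes "linear f"
  shows "f ` sum_space I U = sum_space I (\<lambda>s. f ` U s)"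
proof (intro equalityI subsetI)
  fix y assume "y \<in> f ` sum_space I U"
  then show "y \<in> sum_space I (\<lambda>s. f ` U s)"
    by (auto elim!: sum_spaceE simp: linear_sum[OF assms] intro!: sum_spaceI)
next
  fix y assume "y \<in> sum_space I (\<lambda>s. f ` U s)"
  then obtain x where x: "\<And>s. s \<in> I \<Longrightarrow> x s \<in> f ` U s" "y = (\<Sum>s\<in>I. x s)"
    by (rule sum_spaceE) blast
  then obtain u where "\<And>s. s \<in> I \<Longrightarrow> u s \<in> U s \<and> x s = f (u s)"
    unfolding image_iff by metis
  then show "y \<in> f ` sum_space I U"
    by (intro image_eqI[of _ _ "\<Sum>s\<in>I. u s"]) (auto simp: x(2) linear_sum[OF assms] intro: sum_spaceI)
qed

lemma sum_space_zero: "sum_space I (\<lambda>_. {0}) = {0}"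
  by (force simp: sum_space_def)

text \<open>Bases of the summands unite to a basis of the sum, and their sizes add up because
  independence of the family keeps them disjoint.\<close>

lemma dim_sum_space:
  fixes W :: "'i \<Rightarrow> 'v::real_vector set"
  assumes I: "finite I" and indep: "indep_family I W"
    and W: "\<And>s. s \<in> I \<Longrightarrow> subspace (W s)"
    and fin: "\<And>s. s \<in> I \<Longrightarrow> W s \<subseteq> span F" "finite F"
  shows "dim (sum_space I W) = (\<Sum>s\<in>I. dim (W s))"
proof -
  have "\<exists>K. K \<subseteq> W s \<and> independent K \<and> W s \<subseteq> span K \<and> card K = dim (W s)" for s
    using basis_exists by metis
  then obtain K where K: "\<And>s. K s \<subseteq> W s" "\<And>s. independent (K s)"
      "\<And>s. W s \<subseteq> span (K s)" "\<And>s. card (K s) = dim (W s)"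
    by metis
  have finK: "finite (K s)" if "s \<in> I" for s
    using independent_span_bound[OF fin(2) K(2)] K(1) fin(1)[OF that] by blast
  have disj: "K s \<inter> K t = {}" if st: "s \<in> I" "t \<in> I" "s \<noteq> t" for s t
  proof (rule ccontr)
    assume "K s \<inter> K t \<noteq> {}"
    then obtain x where x: "x \<in> K s" "x \<in> K t" by auto
    \<comment> \<open>The family is \<open>x\<close> at \<open>s\<close>, \<open>- x\<close> at
      \<open>t\<close> and 0 elsewhere. Its sum is 0, which forces \<open>x = 0\<close>.\<close>
    let ?x = "\<lambda>r. (if r = s then x else 0) - (if r = t then x else 0)"
    have "?x s = 0"
    proof (rule indep_familyD[OF indep, where x = ?x])
      show "(\<Sum>r\<in>I. ?x r) = 0" using st I by (simp add: sum_subtractf)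
      show "?x r \<in> W r" if "r \<in> I" for r
        using x K(1)[of s] K(1)[of t] subspace_0[OF W[OF that]] subspace_neg[OF W[OF that], of x]
          by (auto split: if_splits)
    qed (use st in simp)
    then have "x = 0" using st by simp
    then show False using x K(2) dependent_zero by blast
  qed
  have ind: "independent (\<Union>s\<in>I. K s)"
  proof (rule independent_if_scalars_zero)
    show "finite (\<Union>s\<in>I. K s)" using I finK by blast
    fix f x assume f: "(\<Sum>x\<in>(\<Union>s\<in>I. K s). f x *\<^sub>R x) = 0" and "x \<in> (\<Union>s\<in>I. K s)"
    then obtain s where s: "s \<in> I" "x \<in> K s" by auto
    have "(\<Sum>s\<in>I. \<Sum>x\<in>K s. f x *\<^sub>R x) = 0"
      using f sum.UNION_disjoint[OF I, of K "\<lambda>x. f x *\<^sub>R x"] finK disj by auto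
    moreover have "(\<Sum>x\<in>K s. f x *\<^sub>R x) \<in> W s" if "s \<in> I" for s
      using K(1) W[OF that] by (intro subspace_sum subspace_scale) auto
    ultimately have "(\<Sum>x\<in>K s. f x *\<^sub>R x) = 0"
      using indep_familyD[OF indep, of "\<lambda>s. \<Sum>x\<in>K s. f x *\<^sub>R x"] s(1) by blast
    then show "f x = 0"
      using independentD[OF K(2) finK[OF s(1)] subset_refl] s(2) by blast
  qed
  have "dim (sum_space I W) = card (\<Union>s\<in>I. K s)"
  proof (rule dim_unique[OF _ _ ind refl])
    show "(\<Union>s\<in>I. K s) \<subseteq> sum_space I W"
    proof
      fix x assume "x \<in> (\<Union>s\<in>I. K s)"
      then obtain s where s: "s \<in> I" "x \<in> K s" by auto
      have "(\<Sum>r\<in>I. if r = s then x else 0) \<in> sum_space I W"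
        using s K(1) W by (intro sum_spaceI) (auto simp: subspace_0)
      then show "x \<in> sum_space I W" using s I by simp
    qed
    show "sum_space I W \<subseteq> span (\<Union>s\<in>I. K s)"
    proof
      fix y assume "y \<in> sum_space I W"
      then obtain x where x: "\<And>s. s \<in> I \<Longrightarrow> x s \<in> W s" "y = (\<Sum>s\<in>I. x s)"
        by (rule sum_spaceE) blast
      have "x s \<in> span (\<Union>s\<in>I. K s)" if "s \<in> I" for s
        using x(1)[OF that] K(3) span_mono[of "K s" "\<Union>s\<in>I. K s"] that by blast
      then show "y \<in> span (\<Union>s\<in>I. K s)" by (simp add: x(2) span_sum)
    qed
  qed
  also have "\<dots> = (\<Sum>s\<in>I. card (K s))"
    using I finK disj by (intro card_UN_disjoint) auto
  finally show ?thesis by (simp add: K(4))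
qed


section \<open>Quotients of direct sums\<close>

text \<open>Names the elements of a \<open>vs_quotient\<close>, so that the record operations become
  computations with representatives. On a complement of \<open>B\<close> the map
  \<open>coset B\<close> is the bijection to which \<open>vs_dim_eq_dim\<close> is applied.\<close>

definition coset :: "'v::real_vector set \<Rightarrow> 'v \<Rightarrow> 'v set" where
  "coset B z = {z + b |b. b \<in> B}"

lemma mem_coset_iff: "x \<in> coset B z \<longleftrightarrow> x - z \<in> B"
proof
  assume "x - z \<in> B"
  moreover have "x = z + (x - z)" by simp
  ultimately show "x \<in> coset B z" unfolding coset_def by blast
qed (auto simp: coset_def)

lemma coset_eq_iff:
  assumes "subspace B"
  shows "coset B x = coset B y \<longleftrightarrow> x - y \<in> B"
proof
  assume "coset B x = coset B y"
  moreover have "x \<in> coset B x" using assms by (simp add: mem_coset_iff subspace_0)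
  ultimately show "x - y \<in> B" by (simp add: mem_coset_iff)
next
  assume xy: "x - y \<in> B"
  have "z - x \<in> B \<longleftrightarrow> z - y \<in> B" for z
    using subspace_add[OF assms _ xy, of "z - x"] subspace_diff[OF assms _ xy, of "z - y"] by auto
  then show "coset B x = coset B y" by (auto simp: mem_coset_iff)
qed

lemma carr_vs_quotient: "carr (vs_quotient Z B) = coset B ` Z"
  by (auto simp: vs_quotient_def coset_def)

lemma vzero_vs_quotient: "vzero (vs_quotient Z B) = coset B 0"
  by (auto simp: vs_quotient_def coset_def)

lemma vadd_vs_quotient:
  assumes "subspace B"
  shows "vadd (vs_quotient Z B) (coset B x) (coset B y) = coset B (x + y)"
proof (intro equalityI subsetI)
  fix z assume "z \<in> vadd (vs_quotient Z B) (coset B x) (coset B y)"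
  then obtain b c where "b \<in> B" "c \<in> B" "z = (x + b) + (y + c)"
    by (auto simp: vs_quotient_def coset_def)
  then show "z \<in> coset B (x + y)"
    using subspace_add[OF assms] by (auto simp: mem_coset_iff algebra_simps)
next
  fix z assume "z \<in> coset B (x + y)"
  then obtain b where "b \<in> B" "z = (x + b) + (y + 0)"
    by (auto simp: coset_def algebra_simps)
  then show "z \<in> vadd (vs_quotient Z B) (coset B x) (coset B y)"
    using subspace_0[OF assms] by (fastforce simp: vs_quotient_def coset_def)
qed

text \<open>The summand from \<open>B\<close> in \<open>vscale\<close> matters for
  \<open>c = 0\<close>: scaling a coset elementwise would then give \<open>{0}\<close> instead of
  \<open>B\<close>.\<close>

lemma vscale_vs_quotient:
  assumes "subspace B"
  shows "vscale (vs_quotient Z B) c (coset B x) = coset B (c *\<^sub>R x)"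
proof (intro equalityI subsetI)
  fix z assume "z \<in> vscale (vs_quotient Z B) c (coset B x)"
  then obtain b b' where "b \<in> B" "b' \<in> B" "z = c *\<^sub>R (x + b) + b'"
    by (auto simp: vs_quotient_def coset_def)
  then show "z \<in> coset B (c *\<^sub>R x)"
    using subspace_add[OF assms] subspace_scale[OF assms]
    by (auto simp: mem_coset_iff algebra_simps)
next
  fix z assume "z \<in> coset B (c *\<^sub>R x)"
  then obtain b where "b \<in> B" "z = c *\<^sub>R (x + 0) + b"
    by (auto simp: coset_def)
  then show "z \<in> vscale (vs_quotient Z B) c (coset B x)"
    using subspace_0[OF assms] by (fastforce simp: vs_quotient_def coset_def)
qed

text \<open>On \<open>W\<close> the map \<open>coset B\<close> is injective because
  \<open>W \<inter> B\<close> is trivial, and it reaches every class because \<open>ex\<close> moves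
  each representative into \<open>W\<close>.\<close>

lemma vs_dim_quotient_eq_dim:
  fixes Z B W :: "'v::real_vector set"
  assumes B: "subspace B" and W: "subspace W" "W \<subseteq> span F" "finite F"
    and WZ: "W \<subseteq> Z" and WB: "W \<inter> B \<subseteq> {0}" and ex: "\<And>z. z \<in> Z \<Longrightarrow> \<exists>w\<in>W. z - w \<in> B"
  shows "vs_dim (vs_quotient Z B) = dim W"
proof -
  have bij: "bij_betw (coset B) W (carr (vs_quotient Z B))"
    unfolding bij_betw_def carr_vs_quotient
  proof (intro conjI inj_onI equalityI)
    fix x y assume xy: "x \<in> W" "y \<in> W" "coset B x = coset B y"
    then have "x - y \<in> W \<inter> B"
      using coset_eq_iff[OF B] subspace_diff[OF W(1)] by auto
    then show "x = y" using WB by auto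
  next
    show "coset B ` Z \<subseteq> coset B ` W"
    proof (rule image_subsetI)
      fix z assume "z \<in> Z"
      then obtain w where "w \<in> W" "z - w \<in> B" using ex by blast
      then show "coset B z \<in> coset B ` W"
        by (intro image_eqI[of _ _ w]) (simp_all add: coset_eq_iff[OF B])
    qed
    show "coset B ` W \<subseteq> coset B ` Z"
      using WZ by (rule image_mono)
  qed
  show ?thesis
    by (rule vs_dim_eq_dim[where \<phi> = "coset B", OF W(1,3,2) bij vzero_vs_quotient[symmetric]
          vadd_vs_quotient[OF B, symmetric] vscale_vs_quotient[OF B, symmetric]])
qed

lemma vs_dim_quotient_sum_space:
  fixes Z B :: "'i \<Rightarrow> 'v::real_vector set"
  assumes I: "finite I" and indep: "indep_family I U"
    and U: "\<And>s. s \<in> I \<Longrightarrow> subspace (U s)"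
    and Z: "\<And>s. s \<in> I \<Longrightarrow> subspace (Z s)" "\<And>s. s \<in> I \<Longrightarrow> Z s \<subseteq> U s"
    and B: "\<And>s. s \<in> I \<Longrightarrow> subspace (B s)" "\<And>s. s \<in> I \<Longrightarrow> B s \<subseteq> U s"
    and F: "\<And>s. s \<in> I \<Longrightarrow> U s \<subseteq> span F" "finite F"
  shows "vs_dim (vs_quotient (sum_space I Z) (sum_space I B)) =
    (\<Sum>s\<in>I. vs_dim (vs_quotient (Z s) (B s)))"
proof -
  have "\<exists>W. subspace W \<and> W \<subseteq> Z s \<and> W \<inter> B s \<subseteq> {0} \<and> (\<forall>z\<in>Z s. \<exists>w\<in>W. z - w \<in> B s)"
    if s: "s \<in> I" for s
    using complement_mod_subspace[OF Z(1)[OF s] B(1)[OF s]] by metis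
  then obtain W where W: "\<And>s. s \<in> I \<Longrightarrow> subspace (W s)" "\<And>s. s \<in> I \<Longrightarrow> W s \<subseteq> Z s"
      "\<And>s. s \<in> I \<Longrightarrow> W s \<inter> B s \<subseteq> {0}"
      "\<And>s z. s \<in> I \<Longrightarrow> z \<in> Z s \<Longrightarrow> \<exists>w\<in>W s. z - w \<in> B s"
    by metis
  have WU: "W s \<subseteq> U s" if "s \<in> I" for s using W(2) Z(2) that by blast
  have WF: "W s \<subseteq> span F" if "s \<in> I" for s using WU F(1) that by blast
  have "vs_dim (vs_quotient (sum_space I Z) (sum_space I B)) = dim (sum_space I W)"
  proof (rule vs_dim_quotient_eq_dim[OF subspace_sum_space subspace_sum_space _ F(2)])
    show "sum_space I W \<subseteq> span F"
      using WF by (auto elim!: sum_spaceE intro!: span_sum)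
    show "sum_space I W \<subseteq> sum_space I Z"
      using W(2) by (fastforce simp: sum_space_def)
    show "sum_space I W \<inter> sum_space I B \<subseteq> {0}"
    proof
      fix x assume "x \<in> sum_space I W \<inter> sum_space I B"
      then have x: "x \<in> sum_space I W" "x \<in> sum_space I B" by auto
      obtain w where w: "\<And>s. s \<in> I \<Longrightarrow> w s \<in> W s" "x = (\<Sum>s\<in>I. w s)"
        using x(1) by (rule sum_spaceE) blast
      obtain b where b: "\<And>s. s \<in> I \<Longrightarrow> b s \<in> B s" "x = (\<Sum>s\<in>I. b s)"
        using x(2) by (rule sum_spaceE) blast
      \<comment> \<open>Both decompositions of \<open>x\<close> have components in the independent
        family \<open>U\<close>. Hence they coincide, and each component lies in
        \<open>W s \<inter> B s\<close>.\<close>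
      have "w s = b s" if "s \<in> I" for s
        by (rule indep_family_eq[OF indep U _ _ _ that])
          (use w b subsetD[OF WU] subsetD[OF B(2)] in auto)
      then have "w s = 0" if "s \<in> I" for s
        using W(3)[OF that] w(1)[OF that] b(1)[OF that] that by auto
      then show "x \<in> {0}" by (simp add: w(2))
    qed
    fix z assume "z \<in> sum_space I Z"
    then obtain y where y: "\<And>s. s \<in> I \<Longrightarrow> y s \<in> Z s" "z = (\<Sum>s\<in>I. y s)"
      by (rule sum_spaceE) blast
    have "\<forall>s\<in>I. \<exists>w. w \<in> W s \<and> y s - w \<in> B s"
      using W(4) y(1) by blast
    then obtain w where w: "\<And>s. s \<in> I \<Longrightarrow> w s \<in> W s \<and> y s - w s \<in> B s"
      by metis
    show "\<exists>w\<in>sum_space I W. z - w \<in> sum_space I B"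
      by (rule bexI[of _ "\<Sum>s\<in>I. w s"])
        (use w in \<open>auto simp: y(2) sum_subtractf[symmetric] intro!: sum_spaceI\<close>)
  qed (use W(1) B(1) in auto)
  also have "\<dots> = (\<Sum>s\<in>I. dim (W s))"
    by (rule dim_sum_space[OF I indep_family_mono[OF indep WU] W(1) WF F(2)])
  also have "\<dots> = (\<Sum>s\<in>I. vs_dim (vs_quotient (Z s) (B s)))"
    using vs_dim_quotient_eq_dim[OF B(1) W(1) WF F(2) W(2,3,4)] by simp
  finally show ?thesis .
qed

lemma vs_iso_quotient_sum_space:
  fixes Z B :: "'i \<Rightarrow> 'v::real_vector set"
  assumes indep: "indep_family I U"
    and U: "\<And>s. s \<in> I \<Longrightarrow> subspace (U s)"
    and Z: "\<And>s. s \<in> I \<Longrightarrow> subspace (Z s)" "\<And>s. s \<in> I \<Longrightarrow> Z s \<subseteq> U s"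
    and B: "\<And>s. s \<in> I \<Longrightarrow> subspace (B s)" "\<And>s. s \<in> I \<Longrightarrow> B s \<subseteq> U s"
  shows "vs_iso (\<lambda>\<xi>. {(\<Sum>s\<in>I. z s) + b |z b. (\<forall>s\<in>I. z s \<in> \<xi> s) \<and> b \<in> sum_space I B})
    (vs_direct_sum I (\<lambda>s. vs_quotient (Z s) (B s)))
    (vs_quotient (sum_space I Z) (sum_space I B))"
    (is "vs_iso ?f ?V ?Q")
proof -
  have B': "subspace (sum_space I B)" by (rule subspace_sum_space[OF B(1)])
  \<comment> \<open>Well-definedness: another choice of representatives changes the sum only by an
    element of \<open>sum_space I B\<close>, so the union over all choices is one coset. All later
    claims are computed on representatives with this formula.\<close>
  have f: "?f \<xi> = coset (sum_space I B) (\<Sum>s\<in>I. r s)"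
    if \<xi>: "\<And>s. s \<in> I \<Longrightarrow> \<xi> s = coset (B s) (r s)" for \<xi> r
  proof (intro equalityI subsetI)
    fix x assume "x \<in> ?f \<xi>"
    then obtain z b where "\<forall>s\<in>I. z s \<in> \<xi> s" and b: "b \<in> sum_space I B"
        and x: "x = (\<Sum>s\<in>I. z s) + b"
      by blast
    then have z: "z s - r s \<in> B s" if "s \<in> I" for s
      using \<xi>[OF that] that mem_coset_iff by blast
    have "(\<Sum>s\<in>I. z s - r s) + b \<in> sum_space I B"
      by (rule subspace_add[OF B' sum_spaceI[OF z] b])
    then show "x \<in> coset (sum_space I B) (\<Sum>s\<in>I. r s)"
      by (simp add: mem_coset_iff x sum_subtractf algebra_simps)
  next
    fix x assume "x \<in> coset (sum_space I B) (\<Sum>s\<in>I. r s)"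
    then obtain b where b: "b \<in> sum_space I B" "x = (\<Sum>s\<in>I. r s) + b"
      by (auto simp: coset_def)
    moreover have "\<forall>s\<in>I. r s \<in> \<xi> s"
      using \<xi> subspace_0[OF B(1)] by (simp add: mem_coset_iff)
    ultimately show "x \<in> ?f \<xi>" by blast
  qed
  have reps: "\<exists>r. (\<forall>s\<in>I. r s \<in> Z s) \<and> (\<forall>s\<in>I. \<xi> s = coset (B s) (r s))" if "\<xi> \<in> carr ?V" for \<xi>
  proof -
    have "\<forall>s\<in>I. \<exists>z. z \<in> Z s \<and> \<xi> s = coset (B s) z"
      using that by (fastforce simp: vs_direct_sum_def carr_vs_quotient PiE_iff)
    then show ?thesis by metis
  qed
  have inj: "inj_on ?f (carr ?V)"
  proof (rule inj_onI)
    fix \<xi> \<eta> assume V: "\<xi> \<in> carr ?V" "\<eta> \<in> carr ?V" and eq: "?f \<xi> = ?f \<eta>"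
    obtain r where r: "\<And>s. s \<in> I \<Longrightarrow> r s \<in> Z s" "\<And>s. s \<in> I \<Longrightarrow> \<xi> s = coset (B s) (r s)"
      using reps[OF V(1)] by blast
    obtain t where t: "\<And>s. s \<in> I \<Longrightarrow> t s \<in> Z s" "\<And>s. s \<in> I \<Longrightarrow> \<eta> s = coset (B s) (t s)"
      using reps[OF V(2)] by blast
    have "coset (sum_space I B) (\<Sum>s\<in>I. r s) = coset (sum_space I B) (\<Sum>s\<in>I. t s)"
      using eq f[of \<xi> r, OF r(2)] f[of \<eta> t, OF t(2)] by simp
    then have "(\<Sum>s\<in>I. r s - t s) \<in> sum_space I B"
      by (simp add: coset_eq_iff[OF B'] sum_subtractf)
    then obtain b where b: "\<And>s. s \<in> I \<Longrightarrow> b s \<in> B s" "(\<Sum>s\<in>I. r s - t s) = (\<Sum>s\<in>I. b s)"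
      by (rule sum_spaceE) blast
    \<comment> \<open>Directness gives injectivity: a total difference in
      \<open>sum_space I B\<close> already has each component in the respective
      \<open>B s\<close>.\<close>
    have rt: "r s - t s = b s" if "s \<in> I" for s
      by (rule indep_family_eq[OF indep U _ _ b(2) that])
        (use r(1) t(1) b(1) subsetD[OF Z(2)] subsetD[OF B(2)] in \<open>auto intro!: subspace_diff[OF U]\<close>)
    show "\<xi> = \<eta>"
    proof (rule PiE_ext)
      show "\<xi> \<in> (\<Pi>\<^sub>E s\<in>I. UNIV)" "\<eta> \<in> (\<Pi>\<^sub>E s\<in>I. UNIV)"
        using V by (auto simp: vs_direct_sum_def PiE_iff)
      fix s assume s: "s \<in> I"
      then show "\<xi> s = \<eta> s"
        using rt[OF s] b(1)[OF s] by (simp add: r(2) t(2) coset_eq_iff[OF B(1)])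
    qed
  qed
  have img: "?f ` carr ?V = carr ?Q"
  proof (intro equalityI subsetI)
    fix X assume "X \<in> ?f ` carr ?V"
    then obtain \<xi> where \<xi>: "\<xi> \<in> carr ?V" "X = ?f \<xi>" by blast
    obtain r where r: "\<And>s. s \<in> I \<Longrightarrow> r s \<in> Z s" "\<And>s. s \<in> I \<Longrightarrow> \<xi> s = coset (B s) (r s)"
      using reps[OF \<xi>(1)] by blast
    show "X \<in> carr ?Q"
      using f[of \<xi> r, OF r(2)] sum_spaceI[of I r Z, OF r(1)] by (simp add: \<xi>(2) carr_vs_quotient)
  next
    fix X assume "X \<in> carr ?Q"
    then obtain r where r: "\<And>s. s \<in> I \<Longrightarrow> r s \<in> Z s"
        and X: "X = coset (sum_space I B) (\<Sum>s\<in>I. r s)"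
      by (auto simp: carr_vs_quotient elim!: sum_spaceE)
    let ?\<xi> = "\<lambda>s\<in>I. coset (B s) (r s)"
    have "X = ?f ?\<xi>" using f[of ?\<xi> r] X by simp
    moreover have "?\<xi> \<in> carr ?V"
      using r by (auto simp: vs_direct_sum_def carr_vs_quotient)
    ultimately show "X \<in> ?f ` carr ?V" by (rule image_eqI)
  qed
  have add: "?f (vadd ?V \<xi> \<eta>) = vadd ?Q (?f \<xi>) (?f \<eta>)"
    if V: "\<xi> \<in> carr ?V" "\<eta> \<in> carr ?V" for \<xi> \<eta>
  proof -
    obtain r where r: "\<And>s. s \<in> I \<Longrightarrow> r s \<in> Z s" "\<And>s. s \<in> I \<Longrightarrow> \<xi> s = coset (B s) (r s)"
      using reps[OF V(1)] by blast
    obtain t where t: "\<And>s. s \<in> I \<Longrightarrow> t s \<in> Z s" "\<And>s. s \<in> I \<Longrightarrow> \<eta> s = coset (B s) (t s)"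
      using reps[OF V(2)] by blast
    have "vadd ?V \<xi> \<eta> s = coset (B s) (r s + t s)" if "s \<in> I" for s
      using that by (simp add: vs_direct_sum_def r(2) t(2) vadd_vs_quotient[OF B(1)])
    from f[of "vadd ?V \<xi> \<eta>" "\<lambda>s. r s + t s", OF this]
    have "?f (vadd ?V \<xi> \<eta>) = coset (sum_space I B) (\<Sum>s\<in>I. r s + t s)" .
    also have "\<dots> = vadd ?Q (?f \<xi>) (?f \<eta>)"
      unfolding sum.distrib vadd_vs_quotient[OF B', where Z = "sum_space I Z", symmetric]
      by (rule arg_cong2[OF f[OF r(2), symmetric] f[OF t(2), symmetric]])
    finally show ?thesis .
  qed
  have scale: "?f (vscale ?V c \<xi>) = vscale ?Q c (?f \<xi>)" if V: "\<xi> \<in> carr ?V" for c \<xi>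
  proof -
    obtain r where r: "\<And>s. s \<in> I \<Longrightarrow> r s \<in> Z s" "\<And>s. s \<in> I \<Longrightarrow> \<xi> s = coset (B s) (r s)"
      using reps[OF V] by blast
    have "vscale ?V c \<xi> s = coset (B s) (c *\<^sub>R r s)" if "s \<in> I" for s
      using that by (simp add: vs_direct_sum_def r(2) vscale_vs_quotient[OF B(1)])
    from f[of "vscale ?V c \<xi>" "\<lambda>s. c *\<^sub>R r s", OF this]
    have "?f (vscale ?V c \<xi>) = coset (sum_space I B) (\<Sum>s\<in>I. c *\<^sub>R r s)" .
    also have "\<dots> = vscale ?Q c (?f \<xi>)"
      unfolding scaleR_sum_right[symmetric] vscale_vs_quotient[OF B', where Z = "sum_space I Z", symmetric]
      by (rule arg_cong[OF f[OF r(2), symmetric]])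
    finally show ?thesis .
  qed
  show ?thesis
    unfolding vs_iso_def bij_betw_def by (intro conjI ballI allI inj img add scale)
qed

text \<open>All four fields evaluate the family only at indices in \<open>I\<close>. This matters
  because the cohomology of \<open>induced G S\<close> is identified only for
  \<open>S \<subseteq> vertices G\<close>.\<close>

lemma vs_direct_sum_cong:
  assumes "\<And>s. s \<in> I \<Longrightarrow> F s = F' s"
  shows "vs_direct_sum I F = vs_direct_sum I F'"
  unfolding vs_direct_sum_def using assms
  by (simp add: fun_eq_iff restrict_def cong: PiE_cong)

section \<open>The differential and supports of monomials\<close>

text \<open>\<open>lin_ext\<close> sums over the keys of its argument, which differ for
  \<open>p\<close>, \<open>q\<close> and \<open>p + q\<close>. A common finite superset lets these
  sums be compared term by term.\<close>

lemma lin_ext_superset: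
  assumes "finite K" "Poly_Mapping.keys p \<subseteq> K"
  shows "lin_ext f p = (\<Sum>k\<in>K. Poly_Mapping.lookup p k *\<^sub>R f k)"
  unfolding lin_ext_def
  by (rule sum.mono_neutral_left[OF assms]) (auto simp: in_keys_iff)

lemma linear_lin_ext: "linear (lin_ext f)"
proof (rule linearI)
  fix p q :: "'a \<Rightarrow>\<^sub>0 real" and c :: real
  let ?K = "Poly_Mapping.keys p \<union> Poly_Mapping.keys q"
  have fin: "finite ?K" by simp
  have sub: "Poly_Mapping.keys (p + q) \<subseteq> ?K" by (rule Poly_Mapping.keys_add)
  show "lin_ext f (p + q) = lin_ext f p + lin_ext f q"
    unfolding lin_ext_superset[OF fin sub] lin_ext_superset[OF fin, of p, OF Un_upper1]
      lin_ext_superset[OF fin, of q, OF Un_upper2]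
    by (simp add: lookup_add scaleR_add_left sum.distrib)
  have "Poly_Mapping.keys (c *\<^sub>R p) \<subseteq> Poly_Mapping.keys p"
    by (auto simp: in_keys_iff lookup_scaleR)
  then show "lin_ext f (c *\<^sub>R p) = c *\<^sub>R lin_ext f p"
    by (simp add: lin_ext_superset[of "Poly_Mapping.keys p"] lookup_scaleR scaleR_sum_right)
qed

lemma linear_dm_diff: "linear (dm_diff G)"
  unfolding dm_diff_def odd_derivation_def by (rule linear_lin_ext)

lemma odd_derivation_mon:
  "odd_derivation D (mon A) = (\<Sum>a\<in>A. (- 1) ^ card {b\<in>A. b < a} *\<^sub>R
     wedge (wedge (mon {b\<in>A. b < a}) (D a)) (mon {b\<in>A. a < b}))"
  unfolding odd_derivation_def mon_def[of A] lin_ext_single by simp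

lemma wedge_scaleR_mon:
  "wedge (mon A) (c *\<^sub>R mon B) = c *\<^sub>R mon_wedge A B"
  "wedge (c *\<^sub>R mon A) (mon B) = c *\<^sub>R mon_wedge A B"
  unfolding wedge_def
  by (simp_all add: linear_scale[OF linear_lin_ext] mon_def[of A] mon_def[of B])

text \<open>Forgets the sign, which is immaterial for questions of support. Disjointness is kept in
  the first case for the later degree count.\<close>

lemma mon_wedge_cases:
  obtains c where "mon_wedge A B = c *\<^sub>R mon (A \<union> B)" "A \<inter> B = {}" | "mon_wedge A B = 0"
  by (cases "A \<inter> B = {}") (auto simp: mon_wedge_def)

lemma wedge_zero [simp]: "wedge 0 p = 0" "wedge p 0 = 0"
  by (simp_all add: wedge_def lin_ext_zero lin_ext_def[of _ 0])

text \<open>Index set of the monomials spanning \<open>support_cochains\<close>. Writing the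
  spanning set as an image under \<open>mon\<close> lets span lemmas apply and reduces the
  comparison of two graphs to an equality of index sets.\<close>

definition gens_on :: "'a::linorder graph \<Rightarrow> 'a set \<Rightarrow> nat \<Rightarrow> 'a gen set set" where
  "gens_on G S i = {A. A \<subseteq> gens G \<and> card A = i \<and> (\<Union>a\<in>A. gen_vertices a) = S}"

lemma support_cochains_eq: "support_cochains G S i = span (mon ` gens_on G S i)"
  unfolding support_cochains_def gens_on_def by (rule arg_cong[of _ _ span]) auto

lemma dm_diff_gen_eq: "dm_diff_gen G a = dm_diff G (mon {a})"
  by (simp add: dm_diff_def odd_derivation_var)

lemma finite_gens:
  assumes "simple_graph G"
  shows "finite (gens G)"
proof (rule finite_subset)
  show "gens G \<subseteq> Vtx ` vertices G \<union> case_prod Edg ` (vertices G \<times> vertices G)"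
    using assms by (fastforce simp: gens_def simple_graph_def)
  show "finite (Vtx ` vertices G \<union> case_prod Edg ` (vertices G \<times> vertices G))"
    using assms by (simp add: simple_graph_def)
qed

lemma dm_diff_gen_cases:
  assumes "simple_graph G" "a \<in> gens G"
  obtains "dm_diff_gen G a = 0"
  | c i j where "a = Edg i j" "i < j" "Vtx i \<in> gens G" "Vtx j \<in> gens G"
      "dm_diff_gen G a = c *\<^sub>R mon {Vtx i, Vtx j}"
proof (cases a)
  case (Vtx i)
  then show thesis using that(1) by (simp add: dm_diff_gen_eq dm_diff_Vtx)
next
  case (Edg i j)
  then have ij: "i < j" "{i, j} \<in> edges G" using assms(2) by (auto simp: gens_def)
  then have "{i, j} \<subseteq> vertices G" using assms(1) by (auto simp: simple_graph_def)
  then have v: "Vtx i \<in> gens G" "Vtx j \<in> gens G" by (auto simp: gens_def)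
  have "dm_diff_gen G a = mon_wedge {Vtx i} {Vtx j}"
    by (simp add: dm_diff_gen_eq Edg dm_diff_Edg[OF assms(1) ij(2,1)])
  moreover have "{Vtx i} \<union> {Vtx j} = {Vtx i, Vtx j}" by auto
  ultimately show thesis
    using that(1) that(2)[OF Edg ij(1) v] by (cases rule: mon_wedge_cases[of "{Vtx i}" "{Vtx j}"]) auto
qed

text \<open>Each term of the differential replaces a factor \<open>Edg k l\<close> by \<open>Vtx k\<close> and \<open>Vtx l\<close>,
  or vanishes.\<close>

lemma dm_diff_mon_support:
  assumes G: "simple_graph G" and A: "A \<in> gens_on G S i"
  shows "dm_diff G (mon A) \<in> support_cochains G S (Suc i)"
  unfolding dm_diff_def odd_derivation_mon support_cochains_eq
proof (intro span_sum span_scale)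
  fix a assume a: "a \<in> A"
  have sub: "A \<subseteq> gens G" and card: "card A = i" and supp: "(\<Union>a\<in>A. gen_vertices a) = S"
    using A by (auto simp: gens_on_def)
  have finA: "finite A" using finite_subset[OF sub finite_gens[OF G]] .
  let ?L = "{b\<in>A. b < a}" and ?R = "{b\<in>A. a < b}"
  have split: "A = insert a (?L \<union> ?R)" using a by auto
  have "a \<in> gens G" using a sub by blast
  with G show "wedge (wedge (mon ?L) (dm_diff_gen G a)) (mon ?R) \<in> span (mon ` gens_on G S (Suc i))"
  proof (cases rule: dm_diff_gen_cases)
    case 1
    then show ?thesis by (simp add: span_zero)
  next
    case (2 c k l)
    let ?M = "{Vtx k, Vtx l}"
    have w: "wedge (mon ?L) (dm_diff_gen G a) = c *\<^sub>R mon_wedge ?L ?M"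
      unfolding 2(5) by (rule wedge_scaleR_mon)
    show ?thesis
    proof (cases rule: mon_wedge_cases[of ?L ?M])
      case (1 d)
      have w': "wedge (wedge (mon ?L) (dm_diff_gen G a)) (mon ?R) = (c * d) *\<^sub>R mon_wedge (?L \<union> ?M) ?R"
        unfolding w 1(1) scaleR_scaleR by (rule wedge_scaleR_mon)
      show ?thesis
      proof (cases rule: mon_wedge_cases[of "?L \<union> ?M" ?R])
        case (1 e)
        let ?B = "?L \<union> ?M \<union> ?R"
        \<comment> \<open>A vertex variable occurring twice would make one of the two products
          vanish. In the remaining case one generator is lost and two new ones are gained, which
          raises the degree by exactly one.\<close>
        have disj: "(?L \<union> ?R) \<inter> ?M = {}" using \<open>?L \<inter> ?M = {}\<close> 1(2) by blast
        have B: "?B = (?L \<union> ?R) \<union> ?M" by blast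
        have "card A = Suc (card (?L \<union> ?R))"
          by (subst split, subst card_insert_disjoint) (use finA in auto)
        moreover have "card ?B = card (?L \<union> ?R) + card ?M"
          unfolding B by (rule card_Un_disjoint) (use finA disj in auto)
        moreover have "card ?M = 2" using 2(2) by auto
        ultimately have "card ?B = Suc i" using card by simp
        moreover have "?B \<subseteq> gens G" using sub 2(3,4) by auto
        moreover have "(\<Union>b\<in>?B. gen_vertices b) = S"
        proof -
          have "(\<Union>b\<in>?B. gen_vertices b) = (\<Union>b\<in>?L \<union> ?R. gen_vertices b) \<union> {k, l}"
            unfolding B UN_Un by (simp add: insert_commute)
          also have "\<dots> = (\<Union>b\<in>insert a (?L \<union> ?R). gen_vertices b)"
            unfolding UN_insert 2(1) gen_vertices.simps by (rule Un_commute)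
          finally show ?thesis using split supp by simp
        qed
        ultimately have "?B \<in> gens_on G S (Suc i)" by (simp add: gens_on_def)
        then show ?thesis
          unfolding w' 1(1) by (intro span_scale span_base imageI)
      qed (simp add: w' span_zero)
    qed (simp add: w span_zero)
  qed
qed

lemma dm_diff_support_cochains:
  assumes "simple_graph G" "x \<in> support_cochains G S i"
  shows "dm_diff G x \<in> support_cochains G S (Suc i)"
proof -
  have "dm_diff G ` span (mon ` gens_on G S i) = span (dm_diff G ` mon ` gens_on G S i)"
    by (rule linear_span_image[OF linear_dm_diff, symmetric])
  also have "\<dots> \<subseteq> support_cochains G S (Suc i)"
    using dm_diff_mon_support[OF assms(1)]
    by (intro span_minimal) (auto simp: support_cochains_def)
  finally show ?thesis using assms(2) by (auto simp: support_cochains_eq)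
qed

section \<open>Induced subgraphs\<close>

lemma simple_graph_induced:
  "simple_graph G \<Longrightarrow> S \<subseteq> vertices G \<Longrightarrow> simple_graph (induced G S)"
  by (auto simp: simple_graph_def induced_def intro: finite_subset)

lemma gens_induced:
  "S \<subseteq> vertices G \<Longrightarrow> gens (induced G S) = {a \<in> gens G. gen_vertices a \<subseteq> S}"
  by (auto simp: gens_def induced_def)

text \<open>A generator in a monomial with vertex set \<open>S\<close> touches only vertices of
  \<open>S\<close>, so it already belongs to the induced graph.\<close>

lemma gens_on_induced:
  assumes "S \<subseteq> vertices G"
  shows "gens_on (induced G S) S i = gens_on G S i"
  unfolding gens_on_def gens_induced[OF assms] by blast

text \<open>The defining sums of \<open>dm_diff_gen\<close> range over the generators of two
  different graphs. The explicit values on vertex and edge variables avoid comparing them.\<close>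

lemma dm_diff_gen_induced:
  assumes G: "simple_graph G" and S: "S \<subseteq> vertices G" and a: "a \<in> gens (induced G S)"
  shows "dm_diff_gen (induced G S) a = dm_diff_gen G a"
proof (cases a)
  case (Vtx i)
  then show ?thesis by (simp add: dm_diff_gen_eq dm_diff_Vtx)
next
  case (Edg i j)
  then have "i < j" "{i, j} \<in> edges (induced G S)" using a by (auto simp: gens_def)
  moreover then have "{i, j} \<in> edges G" by (simp add: induced_def)
  ultimately show ?thesis
    by (simp only: dm_diff_gen_eq Edg dm_diff_Edg[OF G] dm_diff_Edg[OF simple_graph_induced[OF G S]])
qed

text \<open>Both differentials are linear, and on a monomial an odd derivation sees only its values
  on the variables that occur, all of which belong to the induced graph.\<close>

lemma dm_diff_induced:
  assumes G: "simple_graph G" and S: "S \<subseteq> vertices G" and x: "x \<in> support_cochains G S i"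
  shows "dm_diff (induced G S) x = dm_diff G x"
proof (rule linear_eq_on_span[OF linear_dm_diff linear_dm_diff _ x[unfolded support_cochains_eq]])
  fix y assume "y \<in> mon ` gens_on G S i"
  then obtain A where A: "y = mon A" "A \<subseteq> gens (induced G S)"
    by (auto simp: gens_on_induced[OF S, symmetric]) (auto simp: gens_on_def)
  show "dm_diff (induced G S) y = dm_diff G y"
    unfolding A(1) dm_diff_def odd_derivation_mon
    by (rule sum.cong[OF refl]) (use A(2) dm_diff_gen_induced[OF G S] in auto)
qed

section \<open>The decomposition by vertex sets\<close>

lemma lookup_support_cochains:
  assumes "x \<in> support_cochains G S i" "(\<Union>a\<in>A. gen_vertices a) \<noteq> S"
  shows "Poly_Mapping.lookup x A = 0"
proof -
  \<comment> \<open>Vanishing of one coefficient is a linear condition, so it has to be checked only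
    on the spanning monomials.\<close>
  have "subspace {x :: 'a gen skew_poly. Poly_Mapping.lookup x A = 0}"
    by (rule subspaceI) (auto simp: lookup_add lookup_scaleR)
  then have "support_cochains G S i \<subseteq> {x. Poly_Mapping.lookup x A = 0}"
    unfolding support_cochains_eq using assms(2)
    by (intro span_minimal) (auto simp: gens_on_def mon_def lookup_single when_def split: if_splits)
  then show ?thesis using assms(1) by blast
qed

text \<open>A monomial can occur only in the summand of its own vertex set, so its coefficient there
  equals its coefficient in the total sum.\<close>

lemma indep_family_support_cochains:
  assumes "finite I"
  shows "indep_family I (\<lambda>S. support_cochains G S i)"
  unfolding indep_family_def
proof (intro allI impI ballI)
  fix x S assume x: "\<forall>S\<in>I. x S \<in> support_cochains G S i" and sum: "(\<Sum>S\<in>I. x S) = 0" and S: "S \<in> I"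
  show "x S = 0"
  proof (rule poly_mapping_eqI)
    fix A
    show "Poly_Mapping.lookup (x S) A = Poly_Mapping.lookup 0 A"
    proof (cases "(\<Union>a\<in>A. gen_vertices a) = S")
      case True
      have "0 = (\<Sum>T\<in>I. Poly_Mapping.lookup (x T) A)"
        using sum by (simp add: lookup_sum[symmetric])
      also have "\<dots> = (\<Sum>T\<in>{S}. Poly_Mapping.lookup (x T) A)"
        by (rule sum.mono_neutral_right[OF assms])
          (use S x True in \<open>auto intro!: lookup_support_cochains\<close>)
      finally show ?thesis by simp
    next
      case False
      then show ?thesis using x S lookup_support_cochains by fastforce
    qed
  qed
qed

text \<open>Each monomial goes into the summand of its own vertex set. In degree 0 the constants
  form the summand of the empty set, hence \<open>support_cochains\<close> rather than
  \<open>dm_subcomplex\<close>.\<close>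

lemma dm_cochains_eq_sum_space:
  assumes G: "simple_graph G"
  shows "dm_cochains G i = sum_space (Pow (vertices G)) (\<lambda>S. support_cochains G S i)" (is "_ = ?R")
proof
  have finV: "finite (Pow (vertices G))" using G by (simp add: simple_graph_def)
  have sp: "subspace (support_cochains G S i)" for S by (simp add: support_cochains_def)
  show "dm_cochains G i \<subseteq> ?R"
    unfolding dm_cochains_def
  proof (rule span_minimal[OF _ subspace_sum_space[OF sp]], rule subsetI)
    fix x assume "x \<in> {mon A |A. A \<subseteq> gens G \<and> card A = i}"
    then obtain A where A: "x = mon A" "A \<subseteq> gens G" "card A = i" by blast
    let ?S = "\<Union>a\<in>A. gen_vertices a"
    have "gen_vertices a \<subseteq> vertices G" if "a \<in> gens G" for a
      using G that by (auto simp: gens_def simple_graph_def)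
    then have S: "?S \<in> Pow (vertices G)" using A(2) by blast
    have "mon A \<in> support_cochains G ?S i"
      unfolding support_cochains_eq using A by (intro span_base imageI) (simp add: gens_on_def)
    then have "(\<Sum>T\<in>Pow (vertices G). if T = ?S then mon A else 0) \<in> ?R"
      by (intro sum_spaceI) (simp add: subspace_0[OF sp])
    also have "(\<Sum>T\<in>Pow (vertices G). if T = ?S then mon A else 0) = mon A"
      using S finV by simp
    finally show "x \<in> ?R" by (simp add: A(1))
  qed
  have "support_cochains G S i \<subseteq> dm_cochains G i" for S
    unfolding support_cochains_def dm_cochains_def by (rule span_mono) blast
  then show "?R \<subseteq> dm_cochains G i"
    by (auto elim!: sum_spaceE intro!: subspace_sum simp: dm_cochains_def)
qed

text \<open>The two complexes differ only if \<open>H\<close> has no vertices, and then only by the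
  constants in degree 0. The differential kills constants, so leaving them out changes neither
  cocycles nor coboundaries in positive degree.\<close>

lemma essential_eq_unital:
  assumes "i \<ge> 1"
  shows "essential_cohomology H i = unital_essential_cohomology H i"
proof (cases "vertices H = {}")
  case True
  have gv: "gen_vertices a \<noteq> {}" for a :: "'a gen" by (cases a) auto
  have on: "gens_on H {} j = (if j = 0 then {{}} else {})" for j
    using gv by (auto simp: gens_on_def)
  have pos: "support_cochains H {} j = {0}" if "j \<noteq> 0" for j
    using that by (simp add: support_cochains_eq on)
  have "dm_diff H x = 0" if "x \<in> support_cochains H {} 0" for x
  proof (rule linear_eq_on_span[OF linear_dm_diff linear_zero])
    show "x \<in> span (mon ` gens_on H {} 0)" using that by (simp add: support_cochains_eq)
    show "dm_diff H y = 0" if "y \<in> mon ` gens_on H {} 0" for y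
      using that by (auto simp: on dm_diff_def odd_derivation_mon)
  qed
  moreover have "0 \<in> support_cochains H {} 0" by (simp add: support_cochains_def span_zero)
  ultimately have zero: "dm_diff H ` support_cochains H {} 0 = {0}"
    using linear_0[OF linear_dm_diff] by force
  obtain j where j: "i = Suc j" using assms by (cases i) auto
  have "coboundaries (dm_subcomplex H {}) (dm_diff H) i = coboundaries (support_cochains H {}) (dm_diff H) i"
    \<comment> \<open>The delicate case is \<open>j = 0\<close>: in degree 1 the unital coboundaries
      are the image of the constants, the others the image of \<open>{0}\<close>.\<close>
    using zero pos[of j] by (cases "j = 0") (auto simp: j coboundaries_def dm_subcomplex_def linear_0[OF linear_dm_diff])
  moreover have "dm_subcomplex H {} i = support_cochains H {} i"
    using pos[of i] j by (simp add: dm_subcomplex_def)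
  ultimately show ?thesis
    unfolding essential_cohomology_def unital_essential_cohomology_def cohomology_def True by simp
next
  case False
  then have "dm_subcomplex H (vertices H) = support_cochains H (vertices H)"
    by (intro ext) (simp add: dm_subcomplex_def)
  then show ?thesis
    unfolding essential_cohomology_def unital_essential_cohomology_def by simp
qed

section \<open>Cohomology of the whole complex\<close>

lemma lie_cohomology_decomposition:
  fixes G :: "'a::linorder graph"
  assumes G: "simple_graph G"
  shows "vs_iso (canonical_map G i)
      (vs_direct_sum (Pow (vertices G)) (\<lambda>S. unital_essential_cohomology (induced G S) i))
      (lie_cohomology G i)"
    and "betti G i = (\<Sum>S\<in>Pow (vertices G). unital_essential_betti (induced G S) i)"
proof -
  define I where "I = Pow (vertices G)"
  define U where "U = (\<lambda>S. support_cochains G S i)"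
  define Z where "Z = (\<lambda>S. {z \<in> U S. dm_diff G z = 0})"
  define B where "B = (\<lambda>S. coboundaries (support_cochains G S) (dm_diff G) i)"
  have lin: "linear (dm_diff G)" by (rule linear_dm_diff)
  have finI: "finite I" using G by (simp add: I_def simple_graph_def)
  have indep: "indep_family I U" unfolding U_def by (rule indep_family_support_cochains[OF finI])
  have U: "subspace (U S)" for S by (simp add: U_def support_cochains_def)
  have Zs: "subspace (Z S)" for S
    using U[of S] unfolding Z_def subspace_def
    by (auto simp: linear_0[OF lin] linear_add[OF lin] linear_scale[OF lin])
  have ZU: "Z S \<subseteq> U S" for S by (auto simp: Z_def)
  have Bs: "subspace (B S)" for S
    unfolding B_def coboundaries_def
    by (cases i) (auto simp: support_cochains_def intro!: linear_subspace_image[OF lin])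
  have BU: "B S \<subseteq> U S" for S
    using dm_diff_support_cochains[OF G] subspace_0[OF U]
    unfolding B_def U_def coboundaries_def by (cases i) auto
  have dU: "dm_diff G x \<in> support_cochains G S (Suc i)" if "x \<in> U S" for x S
    using dm_diff_support_cochains[OF G] that by (simp add: U_def)
  have C: "dm_cochains G j = sum_space I (\<lambda>S. support_cochains G S j)" for j
    unfolding I_def by (rule dm_cochains_eq_sum_space[OF G])
  have ZZ: "{z \<in> dm_cochains G i. dm_diff G z = 0} = sum_space I Z"
  proof (intro equalityI subsetI)
    fix z assume "z \<in> {z \<in> dm_cochains G i. dm_diff G z = 0}"
    then have "z \<in> sum_space I U" and dz: "dm_diff G z = 0" by (auto simp: C U_def)
    then obtain x where x: "\<And>S. S \<in> I \<Longrightarrow> x S \<in> U S" "z = (\<Sum>S\<in>I. x S)"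
      by (elim sum_spaceE) blast
    \<comment> \<open>The differentials of the components lie in the independent summands of degree
      \<open>Suc i\<close> and add up to zero, so each of them vanishes.\<close>
    have "dm_diff G (x S) = 0" if "S \<in> I" for S
    proof (rule indep_familyD[OF indep_family_support_cochains[OF finI, of G "Suc i"] _ _ that])
      show "(\<Sum>S\<in>I. dm_diff G (x S)) = 0"
        using dz by (simp add: x(2) linear_sum[OF lin])
    qed (use x(1) dU in blast)
    then show "z \<in> sum_space I Z"
      unfolding x(2) by (intro sum_spaceI) (simp add: Z_def x(1))
  next
    fix z assume "z \<in> sum_space I Z"
    then obtain x where x: "\<And>S. S \<in> I \<Longrightarrow> x S \<in> Z S" "z = (\<Sum>S\<in>I. x S)"
      by (rule sum_spaceE) blast
    have "z \<in> sum_space I U"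
      unfolding x(2) using x(1) ZU by (intro sum_spaceI) blast
    moreover have "dm_diff G z = 0"
      unfolding x(2) linear_sum[OF lin] using x(1) by (intro sum.neutral) (auto simp: Z_def)
    ultimately show "z \<in> {z \<in> dm_cochains G i. dm_diff G z = 0}" by (simp add: C U_def)
  qed
  have BB: "coboundaries (dm_cochains G) (dm_diff G) i = sum_space I B"
  proof (cases i)
    case 0
    then show ?thesis by (simp add: coboundaries_def B_def sum_space_zero)
  next
    case (Suc j)
    then show ?thesis
      by (simp add: coboundaries_def B_def C sum_space_linear_image[OF lin])
  qed
  have lie: "lie_cohomology G i = vs_quotient (sum_space I Z) (sum_space I B)"
    unfolding lie_cohomology_def cohomology_def ZZ BB ..
  \<comment> \<open>An equality and not merely an isomorphism: the polynomials of both graphs share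
    one type, the monomials with vertex set \<open>S\<close> are the same, and the differentials
    agree on their span.\<close>
  have ess: "unital_essential_cohomology (induced G S) i = vs_quotient (Z S) (B S)" if "S \<in> I" for S
  proof -
    have S: "S \<subseteq> vertices G" using that by (simp add: I_def)
    have vert: "vertices (induced G S) = S" by (simp add: induced_def)
    have "support_cochains (induced G S) S = support_cochains G S"
      by (auto simp: support_cochains_eq gens_on_induced[OF S])
    moreover have "dm_diff (induced G S) ` support_cochains G S j = dm_diff G ` support_cochains G S j" for j
      by (rule image_cong[OF refl dm_diff_induced[OF G S]])
    moreover have "{z \<in> U S. dm_diff (induced G S) z = 0} = Z S"
      using dm_diff_induced[OF G S] by (auto simp: Z_def U_def)
    ultimately show ?thesis
      unfolding unital_essential_cohomology_def cohomology_def vert B_def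
      by (simp add: U_def coboundaries_def split: nat.split)
  qed
  have ds: "vs_direct_sum I (\<lambda>S. unital_essential_cohomology (induced G S) i) =
      vs_direct_sum I (\<lambda>S. vs_quotient (Z S) (B S))"
    by (rule vs_direct_sum_cong[OF ess])
  \<comment> \<open>Once \<open>BB\<close> rewrites the coboundaries, the canonical map is literally
    the map in \<open>vs_iso_quotient_sum_space\<close>.\<close>
  have map: "canonical_map G i =
      (\<lambda>\<xi>. {(\<Sum>S\<in>I. z S) + b |z b. (\<forall>S\<in>I. z S \<in> \<xi> S) \<and> b \<in> sum_space I B})"
    by (rule ext) (simp only: canonical_map_def BB I_def)
  show "vs_iso (canonical_map G i)
      (vs_direct_sum (Pow (vertices G)) (\<lambda>S. unital_essential_cohomology (induced G S) i))
      (lie_cohomology G i)"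
    unfolding I_def[symmetric] ds lie map
    by (rule vs_iso_quotient_sum_space[OF indep U Zs ZU Bs BU])
  \<comment> \<open>All monomials in the finitely many generators serve as the finite spanning set
    required by the dimension count.\<close>
  have "gens_on G S i \<subseteq> Pow (gens G)" for S by (auto simp: gens_on_def)
  then have F: "U S \<subseteq> span (mon ` Pow (gens G))" for S
    unfolding U_def support_cochains_eq by (intro span_mono image_mono)
  have finF: "finite (mon ` Pow (gens G))" using finite_gens[OF G] by simp
  have "betti G i = (\<Sum>S\<in>I. vs_dim (vs_quotient (Z S) (B S)))"
    unfolding betti_def lie by (rule vs_dim_quotient_sum_space[OF finI indep U Zs ZU Bs BU F finF])
  then show "betti G i = (\<Sum>S\<in>Pow (vertices G). unital_essential_betti (induced G S) i)"
    unfolding unital_essential_betti_def I_def[symmetric] using ess by simp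
qed

theorem theorem17:
  fixes G :: "'a::linorder graph"
  assumes "simple_graph G"
  shows
    "(\<forall>i\<ge>1.
        vs_iso (canonical_map G i)
          (vs_direct_sum (Pow (vertices G)) (\<lambda>S. essential_cohomology (induced G S) i))
          (lie_cohomology G i) \<and>
        betti G i = (\<Sum>S\<in>Pow (vertices G). essential_betti (induced G S) i)) \<and>
     (\<forall>i.
        vs_iso (canonical_map G i)
          (vs_direct_sum (Pow (vertices G)) (\<lambda>S. unital_essential_cohomology (induced G S) i))
          (lie_cohomology G i) \<and>
        betti G i = (\<Sum>S\<in>Pow (vertices G). unital_essential_betti (induced G S) i))"
  using lie_cohomology_decomposition[OF assms]
  by (simp add: essential_eq_unital essential_betti_def unital_essential_betti_def)

end
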